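(* Let $(\mathcal{E},d,\preceq)$ be an ordered Polish space satisfying condition (BMC): every increasing sequence $x_1\preceq x_2\preceq\cdots$ in $\mathcal{E}$ with $x_n\preceq y$ for all $n$ for some $y\in\mathcal{E}$ converges to some $x\in\mathcal{E}$. Let $P$ be a stochastically monotone Markov kernel on $\mathcal{E}$. Assume that there exist $c\in\mathcal{E}$, $\varepsilon>0$ and $N\in\mathbb{N}$ such that, for $A_c=\{x\in\mathcal{E}: x\preceq c\}$ and $B_c=\{x\in\mathcal{E}: x\succeq c\}$, and for any $z\in\mathcal{E}$, $$P^{(N)}(z,A_c)=\mathbf{P}(X_N^z\in A_c)\ge\varepsilon\quad\text{and}\quad P^{(N)}(z,B_c)\ge\varepsilon.$$ Then the Markov chain admits a unique stationary distribution $\pi$, and, for any $x\in\mathcal{E}$ and $n\in\mathbb{N}$, $$\sup_{I\in\mathcal{I}}\big|\mathbf{P}(X_n^x\in I)-\pi(I)\big|\le(1-\varepsilon)^{\lfloor n/N\rfloor}.$$ In particular, there is geometric convergence of the transition probabilities to the stationary distribution in the uniform (Kolmogorov) metric, i.e. with respect to the supremum over $I\in\mathcal{I}$ on the left-hand side.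
   Context: An ordered Polish space is a Polish (complete separable metric) space $(\mathcal{E},d)$ with its Borel $\sigma$-algebra and a partial order $\preceq$ such that $\{(x,y): x\preceq y\}$ is closed in $\mathcal{E}\times\mathcal{E}$. $\mathcal{I}$ denotes the collection of all measurable increasing sets, i.e. Borel sets $I\subseteq\mathcal{E}$ such that $x\in I$ and $x\preceq y$ imply $y\in I$. A Markov kernel $P(x,A)$ on $\mathcal{E}$ is a probability measure in $A$ for each $x$ and measurable in $x$ for each Borel $A$; no Feller property is assumed. $P^{(n)}$ is the $n$-step transition kernel. $P$ is stochastically monotone if, for every measurable increasing $g:\mathcal{E}\to[0,1]$ ($x\preceq y\Rightarrow g(x)\le g(y)$), the function $Pg(x)=\int g(y)P(x,dy)$ is also increasing. $(X_n^x)_{n\in\mathbb{N}_0}$ denotes the time-homogeneous Markov chain with kernel $P$ and $X_0^x=x$. A stationary distribution is a probability measure $\pi$ with $\int P(x,\cdot)\,d\pi(x)=\pi$. *)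

theory Defs
  imports "HOL-Probability.Probability"
begin

definition markov_kernel :: "('a::topological_space \<Rightarrow> 'a measure) \<Rightarrow> bool" where
  "markov_kernel P \<longleftrightarrow> P \<in> borel \<rightarrow>\<^sub>M prob_algebra borel"

text \<open>Elementwise reading of the Giry-monad formulation.\<close>

lemma markov_kernel_iff:
  "markov_kernel P \<longleftrightarrow>
    (\<forall>x. prob_space (P x) \<and> sets (P x) = sets borel) \<and>
    (\<forall>A\<in>sets borel. (\<lambda>x. measure (P x) A) \<in> borel_measurable borel)"
proof (intro iffI conjI allI ballI)
  assume K: "markov_kernel P"
  then have "P x \<in> space (prob_algebra borel)" for x
    unfolding markov_kernel_def by (rule measurable_space) simp
  then show "prob_space (P x)" "sets (P x) = sets borel" for x
    by (auto simp: space_prob_algebra)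
  show "(\<lambda>x. measure (P x) A) \<in> borel_measurable borel" if "A \<in> sets borel" for A
    using K that unfolding markov_kernel_def
    by (intro measurable_compose[OF _ measurable_measure_prob_algebra]) auto
next
  assume *: "(\<forall>x. prob_space (P x) \<and> sets (P x) = sets borel) \<and>
    (\<forall>A\<in>sets borel. (\<lambda>x. measure (P x) A) \<in> borel_measurable borel)"
  have "P \<in> borel \<rightarrow>\<^sub>M subprob_algebra borel"
  proof (rule measurable_subprob_algebra)
    fix A :: "'a set" assume "A \<in> sets borel"
    moreover have "emeasure (P x) A = ennreal (measure (P x) A)" for x
      using * by (intro finite_measure.emeasure_eq_measure prob_space.finite_measure) auto
    ultimately show "(\<lambda>x. emeasure (P x) A) \<in> borel_measurable borel"
      using * by simp
  qed (use * in \<open>auto intro: prob_space_imp_subprob_space\<close>)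
  with * show "markov_kernel P"
    unfolding markov_kernel_def by (intro measurable_prob_algebraI) auto
qed

primrec nstep :: "('a::topological_space \<Rightarrow> 'a measure) \<Rightarrow> nat \<Rightarrow> 'a \<Rightarrow> 'a measure" where
  "nstep P 0 = return borel"
| "nstep P (Suc n) = (\<lambda>x. P x \<bind> nstep P n)"

definition increasing_sets :: "'a::{topological_space, order} set set" where
  "increasing_sets = {I \<in> sets borel. \<forall>x y. x \<in> I \<longrightarrow> x \<le> y \<longrightarrow> y \<in> I}"

definition stochastically_monotone :: "('a::{topological_space, order} \<Rightarrow> 'a measure) \<Rightarrow> bool" where
  "stochastically_monotone P \<longleftrightarrow>
    (\<forall>g::'a \<Rightarrow> real. g \<in> borel_measurable borel \<longrightarrow> range g \<subseteq> {0..1} \<longrightarrow> mono g \<longrightarrow>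
      mono (\<lambda>x. \<integral>y. g y \<partial>P x))"

definition stationary_distribution ::
    "('a::topological_space \<Rightarrow> 'a measure) \<Rightarrow> 'a measure \<Rightarrow> bool" where
  "stationary_distribution P \<pi> \<longleftrightarrow>
    prob_space \<pi> \<and> sets \<pi> = sets borel \<and> \<pi> \<bind> P = \<pi>"

definition natural_filtration ::
    "'w measure \<Rightarrow> (nat \<Rightarrow> 'w \<Rightarrow> 'a::topological_space) \<Rightarrow> nat \<Rightarrow> 'w measure" where
  "natural_filtration M X n =
    sigma (space M) {X i -` A \<inter> space M | i A. i \<le> n \<and> A \<in> sets borel}"

definition markov_chain ::
    "('a::topological_space \<Rightarrow> 'a measure) \<Rightarrow> 'a \<Rightarrow> 'w measure \<Rightarrow> (nat \<Rightarrow> 'w \<Rightarrow> 'a) \<Rightarrow> bool" where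
  "markov_chain P x M X \<longleftrightarrow>
    prob_space M \<and> (\<forall>n. X n \<in> borel_measurable M) \<and> (AE \<omega> in M. X 0 \<omega> = x) \<and>
    (\<forall>n. \<forall>A\<in>sets borel. AE \<omega> in M.
      real_cond_exp M (natural_filtration M X n) (\<lambda>\<omega>'. indicator A (X (Suc n) \<omega>')) \<omega>
        = measure (P (X n \<omega>)) A)"

end

theory Submission
  imports Defs
begin

text \<open>
  Contraction. Let \<open>Q\<close> be the \<open>N\<close>-step kernel and \<open>g\<close> an increasing function with
  \<open>a \<le> g \<le> b\<close>. Below \<open>c\<close> one has \<open>g \<le> g c\<close>, so \<open>Q g \<le> \<epsilon> g(c) + (1 - \<epsilon>) b\<close>, and above \<open>c\<close> one has
  \<open>g \<ge> g c\<close>, so \<open>Q g \<ge> \<epsilon> g(c) + (1 - \<epsilon>) a\<close>. Both bounds contain the same number \<open>g c\<close>, hence \<open>Q\<close>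
  shrinks the oscillation of increasing functions by the factor \<open>1 - \<epsilon>\<close>; by monotonicity of the
  kernel this can be iterated (\<open>oscillation_contraction\<close>). So the \<open>n\<close>-step laws are Cauchy, uniformly
  in the starting point, for the distance that takes the supremum over increasing sets.

  Existence of the limit. A sequence of laws that is Cauchy at a geometric rate is, up to summable
  errors, both stochastically increasing and stochastically decreasing. Two copies of it can
  therefore be realised on one probability space as
  \<open>Y\<^sub>0 \<le> Y\<^sub>1 \<le> \<dots> \<le> Z\<^sub>1 \<le> Z\<^sub>0\<close>, every relation failing only with small probability. By
  Borel-Cantelli the relations hold from some index on, so \<open>Y\<^sub>n\<close> is eventually increasing and bounded
  and converges to some \<open>Y\<close>; as the order is closed, \<open>Y\<^sub>n \<le> Y \<le> Z\<^sub>n\<close> eventually. Integrating any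
  increasing \<open>g\<close> over this sandwich gives \<open>\<integral> g \<partial>\<mu>\<^sub>n \<rightarrow> E g(Y)\<close>, whether \<open>g\<close> is continuous or not
  (\<open>increasing_Cauchy_limit_exists\<close>). Applied to \<open>g = P 1\<^sub>I\<close>, which is increasing but in general
  discontinuous, this shows that the limit law is stationary.

  Coupling. The theorem \<open>monotone_coupling\<close> is a form of Strassen's theorem for a countable chain of
  laws that are only approximately ordered. On finite sets it is a supply-demand theorem,
  \<open>supply_demand_flow\<close>. Every finite set of requirements on the coupling involves only finitely many Borel sets,
  hence a finite partition of the space; compactness of \<open>[0, 1]\<close>-valued set functions glues
  these solutions to a finitely additive coupling, and tightness of the marginals makes it countably additive.

  Uniqueness. An ordered coupling of two laws that agree on all increasing sets lives on the
  diagonal, so increasing sets determine a law (\<open>increasing_sets_determine_measure\<close>). This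
  identifies both \<open>\<pi> P\<close> with \<open>\<pi>\<close> and any further stationary law with \<open>\<pi>\<close>.
\<close>

section \<open>Couplings of finitely supported laws\<close>

text \<open>
  Gale's form of Hall's theorem for real supplies \<open>p\<close> and capacities \<open>q\<close>. Push as much as possible
  along one edge: the amount is limited by the supply of its source, by the capacity of its target
  or by a set of other sources whose supply becomes exactly equal to the capacity of its neighbours. In
  the first two cases a vertex can be deleted, in the third the problem splits into the tight set
  and the rest, which no longer interact.
\<close>

lemma supply_demand_flow:
  fixes p :: "'a \<Rightarrow> real" and q :: "'b \<Rightarrow> real" and R :: "('a \<times> 'b) set"
  assumes "finite A" and "finite B"
    and "\<And>a. a \<in> A \<Longrightarrow> 0 \<le> p a" and "\<And>b. b \<in> B \<Longrightarrow> 0 \<le> q b"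
    and "\<And>S. S \<subseteq> A \<Longrightarrow> sum p S \<le> sum q (R `` S \<inter> B)"
  shows "\<exists>w. (\<forall>a b. 0 \<le> w a b \<and> (w a b \<noteq> 0 \<longrightarrow> a \<in> A \<and> b \<in> B \<and> (a, b) \<in> R)) \<and>
    (\<forall>a\<in>A. (\<Sum>b\<in>B. w a b) = p a) \<and> (\<forall>b\<in>B. (\<Sum>a\<in>A. w a b) \<le> q b)"
  (is "\<exists>w. ?flow A B p q w")
  using assms
proof (induction "card A + card B" arbitrary: A B p q rule: less_induct)
  case (less A B p q)
  note finA = \<open>finite A\<close> and finB = \<open>finite B\<close> and p0 = less.prems(3) and q0 = less.prems(4)
  note hall = less.prems(5)
  let ?N = "\<lambda>S. R `` S \<inter> B"
  have finN: "finite (?N S)" for S using finB by simp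
  have delete_supply: "\<exists>w. ?flow A B p' q' w"
    if a: "a \<in> A" "p' a = 0" and pos: "\<And>a. a \<in> A \<Longrightarrow> 0 \<le> p' a" "\<And>b. b \<in> B \<Longrightarrow> 0 \<le> q' b"
      and h: "\<And>S. S \<subseteq> A \<Longrightarrow> sum p' S \<le> sum q' (?N S)" for a p' q'
  proof -
    have "card (A - {a}) + card B < card A + card B"
      using card_Diff1_less[OF finA a(1)] by simp
    from less.hyps[OF this, of p' q'] finA finB pos h
    obtain w where w: "?flow (A - {a}) B p' q' w" by (auto simp: subset_Diff_insert)
    have wa: "w a b = 0" for b using w by blast
    have "(\<Sum>a\<in>A. w a b) = (\<Sum>a\<in>A - {a}. w a b)" for b
      using finA a wa by (simp add: sum.remove[of A a])
    moreover have "(\<Sum>b\<in>B. w a' b) = p' a'" if "a' \<in> A" for a'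
      using w that a wa by (cases "a' = a") auto
    ultimately have "?flow A B p' q' w" using w by auto
    then show ?thesis by (rule exI[of _ w])
  qed
  have delete_demand: "\<exists>w. ?flow A B p' q' w"
    if b: "b \<in> B" "q' b = 0" and pos: "\<And>a. a \<in> A \<Longrightarrow> 0 \<le> p' a" "\<And>b. b \<in> B \<Longrightarrow> 0 \<le> q' b"
      and h: "\<And>S. S \<subseteq> A \<Longrightarrow> sum p' S \<le> sum q' (?N S)" for b p' q'
  proof -
    have c: "card A + card (B - {b}) < card A + card B"
      using card_Diff1_less[OF finB b(1)] by simp
    have "sum q' (?N S) = sum q' (R `` S \<inter> (B - {b}))" for S
      using finB b by (intro sum.mono_neutral_right) auto
    with less.hyps[OF c, of p' q'] finA finB pos h
    obtain w where w: "?flow A (B - {b}) p' q' w" by auto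
    have wb: "w a b = 0" for a using w by blast
    have "(\<Sum>b\<in>B. w a b) = (\<Sum>b\<in>B - {b}. w a b)" for a
      using finB b wb by (simp add: sum.remove[of B b])
    moreover have "(\<Sum>a\<in>A. w a b') \<le> q' b'" if "b' \<in> B" for b'
      using w that b wb by (cases "b' = b") auto
    ultimately have "?flow A B p' q' w" using w by auto
    then show ?thesis by (rule exI[of _ w])
  qed
  have split_tight: "\<exists>w. ?flow A B p' q' w"
    if S: "S \<subset> A" "S \<noteq> {}" "sum p' S = sum q' (?N S)"
      and pos: "\<And>a. a \<in> A \<Longrightarrow> 0 \<le> p' a" "\<And>b. b \<in> B \<Longrightarrow> 0 \<le> q' b"
      and h: "\<And>S. S \<subseteq> A \<Longrightarrow> sum p' S \<le> sum q' (?N S)" for S p' q'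
  proof -
    have finS: "finite S" using S(1) finA by (meson finite_subset psubset_imp_subset)
    have "card S < card A" using S(1) finA by (rule psubset_card_mono[rotated])
    moreover have "card (?N S) \<le> card B" using finB by (intro card_mono) auto
    ultimately have c1: "card S + card (?N S) < card A + card B" by simp
    have "sum p' S' \<le> sum q' (R `` S' \<inter> ?N S)" if "S' \<subseteq> S" for S'
    proof -
      have "R `` S' \<inter> ?N S = ?N S'" using that by blast
      then show ?thesis using h[of S'] S(1) that by auto
    qed
    then have "\<exists>w. ?flow S (?N S) p' q' w"
      using finS finN S(1) pos by (intro less.hyps[OF c1]) auto
    then obtain w1 where w1: "?flow S (?N S) p' q' w1" ..
    have "card (A - S) < card A"
      using S(1,2) finA by (intro psubset_card_mono) auto
    moreover have "card (B - ?N S) \<le> card B" using finB by (intro card_mono) auto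
    ultimately have c2: "card (A - S) + card (B - ?N S) < card A + card B" by simp
    have "sum p' S' \<le> sum q' (R `` S' \<inter> (B - ?N S))" if "S' \<subseteq> A - S" for S'
    proof -
      have "sum p' S + sum p' S' = sum p' (S \<union> S')"
        using that finS finA by (intro sum.union_disjoint[symmetric]) (auto intro: finite_subset)
      also have "\<dots> \<le> sum q' (?N (S \<union> S'))" using h[of "S \<union> S'"] S(1) that by auto
      also have "?N (S \<union> S') = ?N S \<union> (R `` S' \<inter> (B - ?N S))" by blast
      also have "sum q' \<dots> = sum q' (?N S) + sum q' (R `` S' \<inter> (B - ?N S))"
        using finB by (intro sum.union_disjoint) auto
      finally show ?thesis using S(3) by simp
    qed
    then have "\<exists>w. ?flow (A - S) (B - ?N S) p' q' w"
      using finA finB pos by (intro less.hyps[OF c2]) auto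
    then obtain w2 where w2: "?flow (A - S) (B - ?N S) p' q' w2" ..
    have w1_0: "w1 a b = 0" if "b \<notin> ?N S" for a b using w1 that by blast
    have w2_0: "w2 a b = 0" if "b \<in> ?N S" for a b using w2 that by blast
    define w where "w a b = w1 a b + w2 a b" for a b
    have "(\<Sum>b\<in>B. w a b) = p' a" if a: "a \<in> A" for a
    proof -
      have "(\<Sum>b\<in>B. w1 a b) = (\<Sum>b\<in>?N S. w1 a b)"
        using finB w1 by (intro sum.mono_neutral_right) auto
      moreover have "(\<Sum>b\<in>B. w2 a b) = (\<Sum>b\<in>B - ?N S. w2 a b)"
        using finB w2 by (intro sum.mono_neutral_right) auto
      moreover have "(\<Sum>b\<in>?N S. w1 a b) = (if a \<in> S then p' a else 0)"
        using w1 by (auto intro!: sum.neutral)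
      moreover have "(\<Sum>b\<in>B - ?N S. w2 a b) = (if a \<in> S then 0 else p' a)"
        using w2 a by (auto intro!: sum.neutral)
      ultimately show ?thesis by (simp add: w_def sum.distrib)
    qed
    moreover have "(\<Sum>a\<in>A. w a b) \<le> q' b" if b: "b \<in> B" for b
    proof -
      have "(\<Sum>a\<in>A. w1 a b) = (\<Sum>a\<in>S. w1 a b)"
        using finA S(1) w1 by (intro sum.mono_neutral_right) auto
      moreover have "(\<Sum>a\<in>A. w2 a b) = (\<Sum>a\<in>A - S. w2 a b)"
        using finA w2 by (intro sum.mono_neutral_right) auto
      moreover have "(\<Sum>a\<in>S. w1 a b) \<le> (if b \<in> ?N S then q' b else 0)"
      proof (cases "b \<in> ?N S")
        case True then show ?thesis using w1 by simp
      next
        case False then show ?thesis using w1_0[OF False] by auto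
      qed
      moreover have "(\<Sum>a\<in>A - S. w2 a b) \<le> (if b \<in> ?N S then 0 else q' b)"
        using w2 w2_0[of b] b by (cases "b \<in> ?N S") simp_all
      ultimately show ?thesis by (auto simp: w_def sum.distrib split: if_splits)
    qed
    moreover have "0 \<le> w a b \<and> (w a b \<noteq> 0 \<longrightarrow> a \<in> A \<and> b \<in> B \<and> (a, b) \<in> R)" for a b
    proof -
      have "0 \<le> w1 a b" "w1 a b \<noteq> 0 \<Longrightarrow> a \<in> S \<and> b \<in> B \<and> (a, b) \<in> R" using w1 by blast+
      moreover have "0 \<le> w2 a b" "w2 a b \<noteq> 0 \<Longrightarrow> a \<in> A \<and> b \<in> B \<and> (a, b) \<in> R" using w2 by blast+
      ultimately show ?thesis using S(1) unfolding w_def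
        by (cases "w1 a b = 0") auto
    qed
    ultimately have "?flow A B p' q' w" by simp
    then show ?thesis by (rule exI[of _ w])
  qed
  show ?case
  proof (cases "\<exists>a\<in>A. 0 < p a")
    case False
    then have "\<And>a. a \<in> A \<Longrightarrow> p a = 0" using p0 by force
    then have "?flow A B p q (\<lambda>_ _. 0)" using q0 by simp
    then show ?thesis by (rule exI[of _ "\<lambda>_ _. 0"])
  next
    case True
    then obtain a where a: "a \<in> A" "0 < p a" by blast
    have "0 < sum q (?N {a})" using hall[of "{a}"] a by auto
    then obtain b where b: "b \<in> B" "(a, b) \<in> R"
      by (metis Image_singleton_iff IntE all_not_in_conv less_irrefl sum.empty)
    define \<S> where "\<S> = {S. S \<subseteq> A - {a} \<and> b \<in> ?N S}"
    define slack where "slack S = sum q (?N S) - sum p S" for S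
    \<comment> \<open>the largest amount that can be sent along \<open>(a, b)\<close> without violating the Hall condition\<close>
    define t where "t = Min ({p a, q b} \<union> slack ` \<S>)"
    have fin\<S>: "finite \<S>" using finA unfolding \<S>_def by (auto intro: finite_subset[OF _ finite_Pow_iff[THEN iffD2]])
    have t_mem: "t \<in> {p a, q b} \<union> slack ` \<S>"
      unfolding t_def using fin\<S> by (intro Min_in) auto
    have t_min: "t \<le> x" if "x \<in> {p a, q b} \<union> slack ` \<S>" for x
      unfolding t_def using fin\<S> that by (intro Min_le) auto
    have t_le: "t \<le> p a" "t \<le> q b" "\<And>S. S \<in> \<S> \<Longrightarrow> t \<le> slack S"
      by (rule t_min; blast)+
    have t0: "0 \<le> t"
      using t_mem a b q0 hall by (auto simp: slack_def \<S>_def subset_Diff_insert)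
    define p' where "p' = p(a := p a - t)"
    define q' where "q' = q(b := q b - t)"
    have pos: "\<And>a. a \<in> A \<Longrightarrow> 0 \<le> p' a" "\<And>b. b \<in> B \<Longrightarrow> 0 \<le> q' b"
      using t_le p0 q0 by (auto simp: p'_def q'_def)
    have sum_p': "sum p' S = sum p S - (if a \<in> S then t else 0)" if "S \<subseteq> A" for S
    proof -
      have "finite S" using that finA by (rule finite_subset)
      then have "sum p' S = (\<Sum>x\<in>S. p x - (if x = a then t else 0))"
        by (intro sum.cong) (auto simp: p'_def)
      then show ?thesis using \<open>finite S\<close> by (simp add: sum_subtractf)
    qed
    have sum_q': "sum q' S = sum q S - (if b \<in> S then t else 0)" if "S \<subseteq> B" for S
    proof -
      have "finite S" using that finB by (rule finite_subset)
      then have "sum q' S = (\<Sum>x\<in>S. q x - (if x = b then t else 0))"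
        by (intro sum.cong) (auto simp: q'_def)
      then show ?thesis using \<open>finite S\<close> by (simp add: sum_subtractf)
    qed
    have h: "sum p' S \<le> sum q' (?N S)" if "S \<subseteq> A" for S
    proof (cases "a \<in> S")
      case True
      then have "b \<in> ?N S" using b by blast
      then show ?thesis using True hall[OF that] that sum_p' sum_q' by auto
    next
      case False
      then have "b \<in> ?N S \<Longrightarrow> S \<in> \<S>" using that by (auto simp: \<S>_def)
      then have "b \<in> ?N S \<Longrightarrow> t \<le> sum q (?N S) - sum p S" using t_le(3)[of S] by (simp add: slack_def)
      then show ?thesis using False hall[OF that] sum_p'[OF that] sum_q'[of "?N S"]
        by (cases "b \<in> R `` S \<and> b \<in> B") simp_all
    qed
    have "\<exists>w. ?flow A B p' q' w"
    proof -
      consider "t = p a" | "t = q b" | S where "S \<in> \<S>" "t = slack S" using t_mem by blast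
      then show ?thesis
      proof cases
        case 1
        then show ?thesis using a pos h by (intro delete_supply[of a]) (auto simp: p'_def)
      next
        case 2
        then show ?thesis using b pos h by (intro delete_demand[of b]) (auto simp: q'_def)
      next
        case 3
        then have "S \<subset> A" "S \<noteq> {}" "a \<notin> S" "b \<in> ?N S" using a by (auto simp: \<S>_def)
        then show ?thesis using 3 pos h sum_p'[of S] sum_q'[of "?N S"]
          by (intro split_tight[of S]) (auto simp: slack_def)
      qed
    qed
    then obtain w where w: "?flow A B p' q' w" ..
    define w' where "w' x y = w x y + (if x = a \<and> y = b then t else 0)" for x y
    have "(\<Sum>y\<in>B. w' x y) = p x" if "x \<in> A" for x
      using w that finB b by (cases "x = a") (auto simp: w'_def sum.distrib p'_def)
    moreover have "(\<Sum>x\<in>A. w' x y) \<le> q y" if "y \<in> B" for y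
      using w that finA a by (cases "y = b") (auto simp: w'_def sum.distrib q'_def)
    moreover have "0 \<le> w' x y \<and> (w' x y \<noteq> 0 \<longrightarrow> x \<in> A \<and> y \<in> B \<and> (x, y) \<in> R)" for x y
      using w t0 a b by (auto simp: w'_def)
    ultimately have "?flow A B p q w'" by simp
    then show ?thesis by (rule exI[of _ w'])
  qed
qed

lemma finite_support_pmf_exists:
  fixes f :: "'a \<Rightarrow> real"
  assumes "finite A" and nonneg: "\<And>x. x \<in> A \<Longrightarrow> 0 \<le> f x" and "sum f A = 1"
  shows "\<exists>W. set_pmf W \<subseteq> A \<and> (\<forall>x\<in>A. pmf W x = f x)"
proof -
  define g where "g x = (if x \<in> A then f x else 0)" for x
  have "(\<integral>\<^sup>+x. ennreal (g x) \<partial>count_space UNIV) = (\<Sum>x\<in>A. ennreal (g x))"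
    using \<open>finite A\<close> by (intro nn_integral_count_space') (auto simp: g_def)
  also have "\<dots> = 1" using assms by (subst sum_ennreal) (auto simp: g_def)
  finally have *: "pmf (embed_pmf g) x = g x" for x
    using nonneg by (intro pmf_embed_pmf) (auto simp: g_def)
  have "set_pmf (embed_pmf g) \<subseteq> A" by (auto simp: set_pmf_iff * g_def split: if_splits)
  with * show ?thesis by (intro exI[of _ "embed_pmf g"]) (auto simp: g_def)
qed

text \<open>
  The Hall condition may fail by \<open>\<eta>\<close>: an additional target \<open>None\<close> of capacity \<open>\<eta>\<close>, reachable
  from everywhere, restores it. The mass \<open>d a\<close> that the flow sends there is finally distributed over the unused capacities
  \<open>e b\<close> proportionally; this is the only mass that can lie outside \<open>R\<close>.
\<close>

lemma pmf_coupling_with_defect: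
  fixes p :: "'a pmf" and q :: "'b pmf" and R :: "('a \<times> 'b) set"
  assumes finp: "finite (set_pmf p)" and finq: "finite (set_pmf q)" and "0 \<le> \<eta>"
    and hall: "\<And>S. S \<subseteq> set_pmf p \<Longrightarrow>
      measure_pmf.prob p S \<le> measure_pmf.prob q (R `` S) + \<eta>"
  shows "\<exists>W. map_pmf fst W = p \<and> map_pmf snd W = q \<and> measure_pmf.prob W (- R) \<le> \<eta>"
proof -
  let ?A = "set_pmf p" and ?B = "set_pmf q"
  define R' where "R' = {(a, Some b) |a b. (a, b) \<in> R} \<union> {(a, None) |a. True}"
  define q' where "q' = case_option \<eta> (pmf q)"
  have sum_p: "sum (pmf p) ?A = 1" and sum_q: "sum (pmf q) ?B = 1"
    using finp finq by (auto intro: sum_pmf_eq_1)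
  have "sum (pmf p) S \<le> sum q' (R' `` S \<inter> insert None (Some ` ?B))" if S: "S \<subseteq> ?A" for S
  proof (cases "S = {}")
    case False
    have *: "R' `` S \<inter> insert None (Some ` ?B) = insert None (Some ` (R `` S \<inter> ?B))"
      using False by (auto simp: R'_def)
    have "sum (pmf p) S = measure_pmf.prob p S"
      using S finp by (metis finite_subset measure_measure_pmf_finite)
    also have "\<dots> \<le> measure_pmf.prob q (R `` S \<inter> ?B) + \<eta>"
      using hall[OF S] by (simp add: measure_Int_set_pmf)
    also have "measure_pmf.prob q (R `` S \<inter> ?B) = sum (pmf q) (R `` S \<inter> ?B)"
      using finq by (simp add: measure_measure_pmf_finite)
    also have "sum (pmf q) (R `` S \<inter> ?B) + \<eta> = sum q' (insert None (Some ` (R `` S \<inter> ?B)))"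
      using finq by (subst sum.insert) (auto simp: q'_def sum.reindex)
    finally show ?thesis unfolding * .
  qed simp
  moreover have "0 \<le> q' b" for b using \<open>0 \<le> \<eta>\<close> by (auto simp: q'_def split: option.split)
  ultimately obtain w where
    flow: "\<forall>a b. 0 \<le> w a b \<and> (w a b \<noteq> 0 \<longrightarrow> a \<in> ?A \<and> b \<in> insert None (Some ` ?B) \<and> (a, b) \<in> R')"
    "\<forall>a\<in>?A. (\<Sum>b\<in>insert None (Some ` ?B). w a b) = pmf p a"
    "\<forall>b\<in>insert None (Some ` ?B). (\<Sum>a\<in>?A. w a b) \<le> q' b"
    using supply_demand_flow[of ?A "insert None (Some ` ?B)" "pmf p" q' R'] finp finq
    by (metis finite.insertI finite_imageI pmf_nonneg)
  have "\<And>a b. 0 \<le> w a b" "\<And>a b. w a b \<noteq> 0 \<Longrightarrow> (a, b) \<in> R'"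
    using flow(1) by blast+
  note w = this bspec[OF flow(2)] bspec[OF flow(3)]
  define d where "d a = w a None" for a
  define D where "D = sum d ?A"
  define e where "e b = pmf q b - (\<Sum>a\<in>?A. w a (Some b))" for b
  have d0: "0 \<le> d a" for a by (simp add: d_def w(1))
  have D_le: "D \<le> \<eta>" using w(4)[of None] by (simp add: D_def d_def q'_def)
  have row: "(\<Sum>b\<in>?B. w a (Some b)) = pmf p a - d a" if "a \<in> ?A" for a
    using w(3)[OF that] finq by (subst (asm) sum.insert) (auto simp: sum.reindex d_def)
  have e0: "0 \<le> e b" if "b \<in> ?B" for b using w(4)[of "Some b"] that by (simp add: e_def q'_def)
  have "(\<Sum>b\<in>?B. \<Sum>a\<in>?A. w a (Some b)) = (\<Sum>a\<in>?A. pmf p a - d a)"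
    by (subst sum.swap) (simp add: row)
  then have sum_e: "sum e ?B = D"
    by (simp add: e_def sum_subtractf sum_p sum_q D_def)
  have D0: "0 \<le> D" unfolding D_def by (intro sum_nonneg d0)
  have D_zero: "d a = 0" "e b = 0" if "D = 0" "a \<in> ?A" "b \<in> ?B" for a b
    using that sum_nonneg_eq_0_iff[of ?A d] sum_nonneg_eq_0_iff[of ?B e] finp finq d0 e0 sum_e
    by (auto simp: D_def)
  define v where "v = (\<lambda>(a, b). w a (Some b) + d a * e b / D)"
  have row_v: "(\<Sum>b\<in>?B. v (a, b)) = pmf p a" if "a \<in> ?A" for a
  proof -
    have "(\<Sum>b\<in>?B. v (a, b)) = pmf p a - d a + d a * D / D"
      using row[OF that] by (simp add: v_def sum.distrib sum_e flip: sum_distrib_left sum_divide_distrib)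
    then show ?thesis using D_zero(1)[OF _ that] set_pmf_not_empty[of q] by (cases "D = 0") auto
  qed
  have column_v: "(\<Sum>a\<in>?A. v (a, b)) = pmf q b" if "b \<in> ?B" for b
  proof -
    have "(\<Sum>a\<in>?A. v (a, b)) = pmf q b - e b + D * e b / D"
      by (simp add: v_def sum.distrib D_def e_def flip: sum_distrib_right sum_divide_distrib)
    then show ?thesis using D_zero(2)[OF _ _ that] set_pmf_not_empty[of p] by (cases "D = 0") auto
  qed
  have "0 \<le> v x" if "x \<in> ?A \<times> ?B" for x
    using that w(1) d0 e0 D0 by (auto simp: v_def)
  moreover have "sum v (?A \<times> ?B) = 1"
    using sum_p row_v by (subst sum.cartesian_product') simp
  ultimately obtain W where W: "set_pmf W \<subseteq> ?A \<times> ?B" "\<And>x. x \<in> ?A \<times> ?B \<Longrightarrow> pmf W x = v x"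
    using finite_support_pmf_exists[of "?A \<times> ?B" v] finp finq by auto
  have prob_W: "measure_pmf.prob W E = sum v (E \<inter> ?A \<times> ?B)" for E
  proof -
    have "measure_pmf.prob W E = measure_pmf.prob W (E \<inter> ?A \<times> ?B)"
      using W(1) by (intro measure_prob_cong_0) (auto simp: set_pmf_iff)
    also have "\<dots> = sum v (E \<inter> ?A \<times> ?B)"
      using finp finq W(2) by (subst measure_measure_pmf_finite) auto
    finally show ?thesis .
  qed
  have "map_pmf fst W = p"
  proof (rule pmf_eqI)
    fix a
    have "pmf (map_pmf fst W) a = sum v ((fst -` {a}) \<inter> ?A \<times> ?B)"
      by (simp add: pmf_map prob_W)
    also have "\<dots> = pmf p a"
    proof (cases "a \<in> ?A")
      case True
      then have "(fst -` {a}) \<inter> ?A \<times> ?B = Pair a ` ?B" by auto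
      then show ?thesis using row_v[OF True] by (simp add: sum.reindex inj_on_def)
    next
      case False
      then have "(fst -` {a}) \<inter> ?A \<times> ?B = {}" by auto
      then show ?thesis using False by (metis set_pmf_iff sum.empty)
    qed
    finally show "pmf (map_pmf fst W) a = pmf p a" .
  qed
  moreover have "map_pmf snd W = q"
  proof (rule pmf_eqI)
    fix b
    have "pmf (map_pmf snd W) b = sum v ((snd -` {b}) \<inter> ?A \<times> ?B)"
      by (simp add: pmf_map prob_W)
    also have "\<dots> = pmf q b"
    proof (cases "b \<in> ?B")
      case True
      then have "(snd -` {b}) \<inter> ?A \<times> ?B = (\<lambda>a. (a, b)) ` ?A" by auto
      then show ?thesis using column_v[OF True] by (simp add: sum.reindex inj_on_def)
    next
      case False
      then have "(snd -` {b}) \<inter> ?A \<times> ?B = {}" by auto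
      then show ?thesis using False by (metis set_pmf_iff sum.empty)
    qed
    finally show "pmf (map_pmf snd W) b = pmf q b" .
  qed
  moreover have "measure_pmf.prob W (- R) \<le> \<eta>"
  proof -
    have "w a (Some b) = 0" if "(a, b) \<notin> R" for a b
      using w(2)[of a "Some b"] that by (auto simp: R'_def)
    then have "sum v (- R \<inter> ?A \<times> ?B) = (\<Sum>(a, b)\<in>- R \<inter> ?A \<times> ?B. d a * e b / D)"
      by (intro sum.cong refl) (auto simp: v_def)
    also have "\<dots> \<le> (\<Sum>(a, b)\<in>?A \<times> ?B. d a * e b / D)"
      using finp finq d0 e0 D0 by (intro sum_mono2) auto
    also have "\<dots> = D * D / D"
      unfolding sum_e[symmetric] by (subst (2) sum_e) (simp add: D_def sum_product sum_divide_distrib sum.cartesian_product case_prod_unfold)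
    also have "\<dots> \<le> \<eta>" using D_le \<open>0 \<le> \<eta>\<close> by (cases "D = 0") auto
    finally show ?thesis by (simp add: prob_W)
  qed
  ultimately show ?thesis by blast
qed

text \<open>
  The allowed defect is a difference \<open>F j - F i\<close>, so that defects add up along the chain to a
  defect of the same form. The new law, largest with respect to \<open>key\<close>, is coupled with its predecessor only, and
  this coupling is glued to the old chain along the common marginal.
\<close>

lemma pmf_chain_coupling:
  fixes p :: "nat \<Rightarrow> 'a pmf" and key F :: "nat \<Rightarrow> real" and R :: "('a \<times> 'a) set"
  assumes "finite J" and "inj key" and trans: "trans R"
    and fin: "\<And>i. finite (set_pmf (p i))"
    and hall: "\<And>i j S. key i < key j \<Longrightarrow>
      measure_pmf.prob (p i) S \<le> measure_pmf.prob (p j) (R `` S) + (F j - F i)"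
  shows "\<exists>D::(nat \<Rightarrow> 'a) pmf. (\<forall>j\<in>J. map_pmf (\<lambda>\<omega>. \<omega> j) D = p j) \<and>
    (\<forall>i\<in>J. \<forall>j\<in>J. key i < key j \<longrightarrow> measure_pmf.prob D {\<omega>. (\<omega> i, \<omega> j) \<notin> R} \<le> F j - F i)"
  using \<open>finite J\<close>
proof (induction J rule: finite_ranking_induct[where f = key])
  case empty
  then show ?case by auto
next
  case (insert j J)
  then obtain D :: "(nat \<Rightarrow> 'a) pmf" where D: "\<And>j. j \<in> J \<Longrightarrow> map_pmf (\<lambda>\<omega>. \<omega> j) D = p j"
    "\<And>i j. i \<in> J \<Longrightarrow> j \<in> J \<Longrightarrow> key i < key j \<Longrightarrow>
      measure_pmf.prob D {\<omega>. (\<omega> i, \<omega> j) \<notin> R} \<le> F j - F i" by blast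
  show ?case
  proof (cases "J = {} \<or> j \<in> J")
    case True
    then show ?thesis
    proof
      assume "J = {}"
      then show ?thesis
        by (intro exI[of _ "map_pmf (\<lambda>x _. x) (p j)"]) (simp add: pmf.map_comp o_def)
    next
      assume "j \<in> J"
      then show ?thesis using D by (intro exI[of _ D]) (simp add: insert_absorb)
    qed
  next
    case False
    have fin_key: "finite (key ` J)" using insert.hyps(1) by simp
    then obtain i where i: "i \<in> J" "key i = Max (key ` J)"
      using Max_in[OF fin_key] False by (metis image_iff image_is_empty)
    have i_max: "key k \<le> key i" if "k \<in> J" for k
      unfolding i(2) using fin_key that by (intro Max_ge) auto
    have less_j: "key k < key j" if "k \<in> J" for k
      using insert.hyps(2)[OF that] \<open>inj key\<close> that False
      by (metis inj_eq order_le_less)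
    have "0 \<le> F j - F i"
      using hall[OF less_j[OF i(1)], of UNIV] measure_pmf.prob_le_1[of "p j" "R `` UNIV"]
        measure_pmf.prob_space[of "p i"]
      unfolding space_measure_pmf by linarith
    then obtain W where W: "map_pmf fst W = p i" "map_pmf snd W = p j"
        "measure_pmf.prob W (- R) \<le> F j - F i"
      using pmf_coupling_with_defect[OF fin fin, of "F j - F i" i j R] hall[OF less_j[OF i(1)]]
      by blast
    have "rel_pmf (=) (map_pmf (\<lambda>\<omega>. \<omega> i) D) (map_pmf fst W)"
      using D(1)[OF i(1)] W(1) by (simp add: pmf.rel_eq)
    \<comment> \<open>a coupling of the chain \<open>D\<close> with the pair \<open>W\<close> whose shared coordinate agrees\<close>
    then have "rel_pmf (\<lambda>\<omega> x. \<omega> i = fst x) D W"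
      by (simp add: pmf.rel_map)
    then obtain G where G: "\<And>\<omega> x. (\<omega>, x) \<in> set_pmf G \<Longrightarrow> \<omega> i = fst x"
        "map_pmf fst G = D" "map_pmf snd G = W"
      by (auto elim!: rel_pmf.cases)
    define D' where "D' = map_pmf (\<lambda>z. fun_upd (fst z) j (snd (snd z))) G"
    have D'_old: "measure_pmf.prob D' {\<omega>. (\<omega> k, \<omega> l) \<notin> R} =
        measure_pmf.prob D {\<omega>. (\<omega> k, \<omega> l) \<notin> R}" if "k \<in> J" "l \<in> J" for k l
      using that False unfolding D'_def G(2)[symmetric] by (auto simp: vimage_def intro!: arg_cong[of _ _ "measure_pmf.prob G"])
    have D'_new: "measure_pmf.prob D' {\<omega>. (\<omega> i, \<omega> j) \<notin> R} \<le> F j - F i"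
    proof -
      have "measure_pmf.prob D' {\<omega>. (\<omega> i, \<omega> j) \<notin> R} = measure_pmf.prob G (snd -` (- R))"
        using i(1) False G(1) unfolding D'_def measure_map_pmf
        by (intro measure_pmf.finite_measure_eq_AE) (auto simp: AE_measure_pmf_iff dest!: G(1))
      also have "\<dots> = measure_pmf.prob W (- R)" by (simp flip: G(3))
      finally show ?thesis using W(3) by simp
    qed
    have marginal: "map_pmf (\<lambda>\<omega>. \<omega> k) D' = p k" if "k \<in> insert j J" for k
    proof (cases "k = j")
      case True
      have "map_pmf (\<lambda>\<omega>. \<omega> k) D' = map_pmf snd W"
        unfolding D'_def G(3)[symmetric] using True by (simp add: pmf.map_comp o_def case_prod_unfold)
      then show ?thesis using True W(2) by simp
    next
      case False
      have "map_pmf (\<lambda>\<omega>. \<omega> k) D' = map_pmf (\<lambda>\<omega>. \<omega> k) D"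
        unfolding D'_def G(2)[symmetric] using False by (simp add: pmf.map_comp o_def case_prod_unfold)
      then show ?thesis using False that D(1) by simp
    qed
    have bad: "measure_pmf.prob D' {\<omega>. (\<omega> k, \<omega> l) \<notin> R} \<le> F l - F k"
      if kl: "k \<in> insert j J" "l \<in> insert j J" "key k < key l" for k l
    proof -
      have k: "k \<in> J" using kl less_j by (metis insertE less_asym)
      show ?thesis
      proof (cases "l = j")
        case False
        then show ?thesis using kl k D'_old[of k l] D(2)[of k l] by auto
      next
        case l: True
        show ?thesis
        proof (cases "k = i")
          case False
          then have "key k < key i" using i_max[OF k] \<open>inj key\<close> by (metis inj_eq order_le_less)
          then have "measure_pmf.prob D' {\<omega>. (\<omega> k, \<omega> i) \<notin> R} \<le> F i - F k"
            using D'_old[OF k i(1)] D(2)[OF k i(1)] by simp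
          moreover have "measure_pmf.prob D' {\<omega>. (\<omega> k, \<omega> j) \<notin> R} \<le>
              measure_pmf.prob D' ({\<omega>. (\<omega> k, \<omega> i) \<notin> R} \<union> {\<omega>. (\<omega> i, \<omega> j) \<notin> R})"
            using trans by (intro measure_pmf.finite_measure_mono) (auto dest: transD)
          moreover have "\<dots> \<le> measure_pmf.prob D' {\<omega>. (\<omega> k, \<omega> i) \<notin> R} +
              measure_pmf.prob D' {\<omega>. (\<omega> i, \<omega> j) \<notin> R}"
            by (intro measure_Un_le) auto
          ultimately show ?thesis using D'_new l by simp
        qed (use D'_new l in simp)
      qed
    qed
    show ?thesis
      by (intro exI[of _ D'] conjI ballI impI; (rule marginal bad; assumption))
  qed
qed

section \<open>Finitely additive couplings\<close>

lemma finite_partition_pmf_exists: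
  fixes r :: "'a \<Rightarrow> 'a"
  assumes "prob_space \<mu>" and space: "space \<mu> = UNIV" and fin: "finite (range r)"
    and meas: "\<And>A. r -` A \<in> sets \<mu>"
  shows "\<exists>p. set_pmf p \<subseteq> range r \<and> (\<forall>A. measure_pmf.prob p A = measure \<mu> (r -` A))"
proof -
  interpret prob_space \<mu> by fact
  have sum_range: "(\<Sum>t\<in>A \<inter> range r. measure \<mu> (r -` {t})) = measure \<mu> (r -` A)" for A
  proof -
    have "measure \<mu> (\<Union>t\<in>A \<inter> range r. r -` {t}) = (\<Sum>t\<in>A \<inter> range r. measure \<mu> (r -` {t}))"
      using fin meas by (intro finite_measure_finite_Union) (auto simp: disjoint_family_on_def)
    moreover have "(\<Union>t\<in>A \<inter> range r. r -` {t}) = r -` A" by auto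
    ultimately show ?thesis by simp
  qed
  have "(\<Sum>t\<in>range r. measure \<mu> (r -` {t})) = 1"
    using sum_range[of UNIV] prob_space space by simp
  then obtain p where p: "set_pmf p \<subseteq> range r" "\<And>t. t \<in> range r \<Longrightarrow> pmf p t = measure \<mu> (r -` {t})"
    using finite_support_pmf_exists[OF fin, of "\<lambda>t. measure \<mu> (r -` {t})"] by auto
  have "measure_pmf.prob p A = measure \<mu> (r -` A)" for A
  proof -
    have "measure_pmf.prob p A = measure_pmf.prob p (A \<inter> range r)"
      using p(1) by (intro measure_prob_cong_0) (auto simp: set_pmf_iff)
    also have "\<dots> = (\<Sum>t\<in>A \<inter> range r. measure \<mu> (r -` {t}))"
      using fin p(2) by (subst measure_measure_pmf_finite) (auto intro: sum.cong)
    finally show ?thesis by (simp only: sum_range)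
  qed
  with p(1) show ?thesis by blast
qed

text \<open>
  The order of the indices is that of \<open>key\<close>, which allows order types other than that of the
  naturals, such as one sequence followed by another in reverse; \<open>F\<close> only measures the error. For exactly ordered laws \<open>F\<close> is constant.
\<close>

locale dominated_family =
  fixes \<mu> :: "nat \<Rightarrow> 'a::{polish_space, order} measure" and key F :: "nat \<Rightarrow> real"
  assumes prob: "\<And>i. prob_space (\<mu> i)" and sets_\<mu>: "\<And>i. sets (\<mu> i) = sets borel"
    and inj_key: "inj key"
    and dominated: "\<And>i j I. key i < key j \<Longrightarrow> I \<in> increasing_sets \<Longrightarrow>
      measure (\<mu> i) I \<le> measure (\<mu> j) I + (F j - F i)"
begin

lemma space_\<mu>: "space (\<mu> i) = UNIV"
  using sets_eq_imp_space_eq[OF sets_\<mu>] by simp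

text \<open>
  Points are identified when they belong to the same sets in \<open>\<B>\<close>. On the finitely many classes the
  increasing sets in \<open>\<B>\<close> define a preorder; it has up-sets that are finite unions of finite intersections of such sets, hence increasing
  and measurable; domination on increasing sets is thus exactly the Hall condition.
\<close>

lemma finite_coupling:
  assumes "finite J" and fin: "finite \<B>" and borel: "\<B> \<subseteq> sets borel"
  shows "\<exists>D::(nat \<Rightarrow> 'a) pmf.
    (\<forall>n\<in>J. \<forall>B\<in>\<B>. measure_pmf.prob D {\<omega>. \<omega> n \<in> B} = measure (\<mu> n) B) \<and>
    (\<forall>i\<in>J. \<forall>j\<in>J. key i < key j \<longrightarrow>
      measure_pmf.prob D {\<omega>. \<exists>I\<in>\<B> \<inter> increasing_sets. \<omega> i \<in> I \<and> \<omega> j \<notin> I} \<le> F j - F i)"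
proof -
  define cls where "cls x = {B \<in> \<B>. x \<in> B}" for x
  define r where "r x = inv_into UNIV cls (cls x)" for x
  have cls_r: "cls (r x) = cls x" for x
    unfolding r_def by (rule f_inv_into_f) simp
  have r_mem: "r x \<in> B \<longleftrightarrow> x \<in> B" if "B \<in> \<B>" for x B
    using cls_r[of x] that by (auto simp: cls_def)
  have fin_cls: "finite (cls ` A)" for A
    using fin by (rule finite_subset[rotated, OF finite_Pow_iff[THEN iffD2]]) (auto simp: cls_def)
  have "range r = inv_into UNIV cls ` range cls" by (auto simp: r_def)
  then have fin_r: "finite (range r)" using fin_cls by simp
  have meas_r: "r -` A \<in> sets borel" for A
  proof -
    have "{x. \<forall>B\<in>\<B>. x \<in> B \<longleftrightarrow> B \<in> C} \<in> sets borel" for C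
    proof -
      have "{x. \<forall>B\<in>\<B>. x \<in> B \<longleftrightarrow> B \<in> C} = (\<Inter>B\<in>\<B>. if B \<in> C then B else - B)"
        by (auto split: if_splits)
      also have "\<dots> \<in> sets borel"
      proof (cases "\<B> = {}")
        case False
        then show ?thesis using fin borel by (intro sets.finite_INT) auto
      qed simp
      finally show ?thesis .
    qed
    then have "(\<Union>C\<in>cls ` (r -` A). {x. \<forall>B\<in>\<B>. x \<in> B \<longleftrightarrow> B \<in> C}) \<in> sets borel"
      using fin_cls by (intro sets.finite_UN) auto
    moreover have "r -` A = (\<Union>C\<in>cls ` (r -` A). {x. \<forall>B\<in>\<B>. x \<in> B \<longleftrightarrow> B \<in> C})"
    proof (intro subset_antisym subsetI)
      fix x assume "x \<in> (\<Union>C\<in>cls ` (r -` A). {x. \<forall>B\<in>\<B>. x \<in> B \<longleftrightarrow> B \<in> C})"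
      then obtain y where "r y \<in> A" "cls x = cls y" by (auto simp: cls_def)
      then show "x \<in> r -` A" by (simp add: r_def)
    qed (auto simp: cls_def)
    ultimately show ?thesis by simp
  qed
  have "\<exists>p. set_pmf p \<subseteq> range r \<and> (\<forall>A. measure_pmf.prob p A = measure (\<mu> i) (r -` A))" for i
    using prob space_\<mu> fin_r meas_r sets_\<mu> by (intro finite_partition_pmf_exists) auto
  then obtain p where p: "\<And>i. set_pmf (p i) \<subseteq> range r"
      "\<And>i A. measure_pmf.prob (p i) A = measure (\<mu> i) (r -` A)"
    by metis
  define R where "R = {(x, y). \<forall>I\<in>\<B> \<inter> increasing_sets. x \<in> I \<longrightarrow> y \<in> I}"
  have R_r: "(s, r x) \<in> R \<longleftrightarrow> (s, x) \<in> R" for s x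
    unfolding R_def using r_mem by auto
  have hall: "measure_pmf.prob (p i) S \<le> measure_pmf.prob (p j) (R `` S) + (F j - F i)"
    if less: "key i < key j" for i j S
  proof -
    interpret i: prob_space "\<mu> i" by (rule prob)
    have vimage: "r -` (R `` S) = R `` S" using R_r by auto
    then have "R `` S \<in> sets borel" using meas_r by metis
    then have inc: "R `` S \<in> increasing_sets"
      unfolding increasing_sets_def R_def by blast
    have "(r x, x) \<in> R" for x using R_r[of "r x" x] by (simp add: R_def)
    then have "r -` S \<subseteq> R `` S" by blast
    then have "measure_pmf.prob (p i) S \<le> measure (\<mu> i) (R `` S)"
      using \<open>R `` S \<in> sets borel\<close> sets_\<mu> unfolding p(2) by (intro i.finite_measure_mono) auto
    also have "\<dots> \<le> measure (\<mu> j) (R `` S) + (F j - F i)" by (rule dominated[OF less inc])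
    finally show ?thesis by (simp add: p(2) vimage)
  qed
  have "trans R" unfolding R_def trans_def by blast
  moreover have "finite (set_pmf (p i))" for i using p(1) fin_r by (rule finite_subset)
  ultimately obtain D :: "(nat \<Rightarrow> 'a) pmf" where D: "\<forall>j\<in>J. map_pmf (\<lambda>\<omega>. \<omega> j) D = p j"
      "\<forall>i\<in>J. \<forall>j\<in>J. key i < key j \<longrightarrow> measure_pmf.prob D {\<omega>. (\<omega> i, \<omega> j) \<notin> R} \<le> F j - F i"
    using pmf_chain_coupling[OF \<open>finite J\<close> inj_key, of R p F] hall by blast
  have "measure_pmf.prob D {\<omega>. \<omega> n \<in> B} = measure (\<mu> n) B" if "n \<in> J" "B \<in> \<B>" for n B
  proof -
    have "measure_pmf.prob D {\<omega>. \<omega> n \<in> B} = measure_pmf.prob (p n) B"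
      using D(1)[rule_format, OF \<open>n \<in> J\<close>, symmetric] by (simp add: vimage_def)
    also have "r -` B = B" using r_mem[OF \<open>B \<in> \<B>\<close>] by auto
    then have "measure_pmf.prob (p n) B = measure (\<mu> n) B" by (simp add: p(2))
    finally show ?thesis .
  qed
  moreover have "{\<omega>. \<exists>I\<in>\<B> \<inter> increasing_sets. \<omega> i \<in> I \<and> \<omega> j \<notin> I} = {\<omega>. (\<omega> i, \<omega> j) \<notin> R}"
    for i j :: nat
    by (auto simp: R_def)
  ultimately show ?thesis
    using D(2) by (intro exI[of _ D]) simp
qed

text \<open>
  By Tychonoff's theorem the functions from all subsets of the sequence space to \<open>[0, 1]\<close> form a
  compact space. Each requirement below is a closed condition on finitely many values, and any finite number of
  requirements is met by a finitely supported law.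
\<close>

lemma finitely_additive_coupling:
  "\<exists>f::(nat \<Rightarrow> 'a) set \<Rightarrow> real. (\<forall>A. 0 \<le> f A) \<and> f UNIV = 1 \<and>
    (\<forall>A B. A \<inter> B = {} \<longrightarrow> f (A \<union> B) = f A + f B) \<and>
    (\<forall>n. \<forall>B\<in>sets borel. f {\<omega>. \<omega> n \<in> B} = measure (\<mu> n) B) \<and>
    (\<forall>i j \<I>. key i < key j \<longrightarrow> finite \<I> \<longrightarrow> \<I> \<subseteq> increasing_sets \<longrightarrow>
      f {\<omega>. \<exists>I\<in>\<I>. \<omega> i \<in> I \<and> \<omega> j \<notin> I} \<le> F j - F i)"
proof -
  define K :: "((nat \<Rightarrow> 'a) set \<Rightarrow> real) set" where "K = PiE UNIV (\<lambda>_. {0..1})"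
  define X :: "(nat set \<times> 'a set set) set"
    where "X = {(J, \<B>). finite J \<and> finite \<B> \<and> \<B> \<subseteq> sets borel}"
  define C :: "nat set \<times> 'a set set \<Rightarrow> ((nat \<Rightarrow> 'a) set \<Rightarrow> real) set" where
    "C = (\<lambda>(J, \<B>). {f. f UNIV = 1} \<inter>
      (\<Inter>(A, B)\<in>{(A, B). A \<inter> B = {}}. {f. f (A \<union> B) = f A + f B}) \<inter>
      (\<Inter>n\<in>J. \<Inter>B\<in>\<B>. {f. f {\<omega>. \<omega> n \<in> B} = measure (\<mu> n) B}) \<inter>
      (\<Inter>(i, j)\<in>{(i, j). i \<in> J \<and> j \<in> J \<and> key i < key j}.
        {f. f {\<omega>. \<exists>I\<in>\<B> \<inter> increasing_sets. \<omega> i \<in> I \<and> \<omega> j \<notin> I} \<le> F j - F i}))"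
  have "compact K"
    unfolding K_def using compactin_PiE[of "\<lambda>_. euclidean" UNIV "\<lambda>_. {0..1::real}"]
    by (simp add: euclidean_product_topology)
  have "K \<inter> (\<Inter>x\<in>X. C x) \<noteq> {}"
  proof (rule compact_imp_fip_image[OF \<open>compact K\<close>])
    fix x assume "x \<in> X"
    show "closed (C x)"
      unfolding C_def case_prod_beta
      by (intro closed_Int closed_INT ballI closed_Collect_eq closed_Collect_le continuous_intros
          continuous_on_product_coordinates)
  next
    fix X' assume X': "finite X'" "X' \<subseteq> X"
    obtain D :: "(nat \<Rightarrow> 'a) pmf" where D:
      "\<forall>n\<in>\<Union>(fst ` X'). \<forall>B\<in>\<Union>(snd ` X'). measure_pmf.prob D {\<omega>. \<omega> n \<in> B} = measure (\<mu> n) B"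
      "\<forall>i\<in>\<Union>(fst ` X'). \<forall>j\<in>\<Union>(fst ` X'). key i < key j \<longrightarrow>
        measure_pmf.prob D {\<omega>. \<exists>I\<in>\<Union>(snd ` X') \<inter> increasing_sets. \<omega> i \<in> I \<and> \<omega> j \<notin> I} \<le> F j - F i"
      using finite_coupling[of "\<Union>(fst ` X')" "\<Union>(snd ` X')"] X' by (fastforce simp: X_def)
    have "measure_pmf.prob D \<in> C (J, \<B>)" if J: "(J, \<B>) \<in> X'" for J \<B>
    proof -
      have sub: "J \<subseteq> \<Union>(fst ` X')" "\<B> \<subseteq> \<Union>(snd ` X')" using J by force+
      have "measure_pmf.prob D {\<omega>. \<exists>I\<in>\<B> \<inter> increasing_sets. \<omega> i \<in> I \<and> \<omega> j \<notin> I} \<le> F j - F i"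
        if "i \<in> J" "j \<in> J" "key i < key j" for i j
      proof -
        have "measure_pmf.prob D {\<omega>. \<exists>I\<in>\<B> \<inter> increasing_sets. \<omega> i \<in> I \<and> \<omega> j \<notin> I} \<le>
          measure_pmf.prob D {\<omega>. \<exists>I\<in>\<Union>(snd ` X') \<inter> increasing_sets. \<omega> i \<in> I \<and> \<omega> j \<notin> I}"
          using sub(2) by (intro measure_pmf.finite_measure_mono) auto
        then show ?thesis using D(2) sub(1) that by (meson order_trans subsetD)
      qed
      moreover have "measure_pmf.prob D (A \<union> B) = measure_pmf.prob D A + measure_pmf.prob D B"
        if "A \<inter> B = {}" for A B
        using that by (intro measure_pmf.finite_measure_Union) auto
      moreover have "measure_pmf.prob D {\<omega>. \<omega> n \<in> B} = measure (\<mu> n) B" if "n \<in> J" "B \<in> \<B>" for n B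
        using D(1) sub that by blast
      ultimately show ?thesis
        unfolding C_def by auto
    qed
    then have "measure_pmf.prob D \<in> (\<Inter>x\<in>X'. C x)" by auto
    moreover have "measure_pmf.prob D \<in> K" by (simp add: K_def PiE_UNIV_domain)
    ultimately show "K \<inter> (\<Inter>x\<in>X'. C x) \<noteq> {}" by blast
  qed
  then obtain f where f: "f \<in> K" "\<And>x. x \<in> X \<Longrightarrow> f \<in> C x" by blast
  have X: "f \<in> C (J, \<B>)" if "finite J" "finite \<B>" "\<B> \<subseteq> sets borel" for J \<B>
    using f(2) that by (simp add: X_def)
  have "f UNIV = 1 \<and> (\<forall>A B. A \<inter> B = {} \<longrightarrow> f (A \<union> B) = f A + f B)"
    using X[of "{}" "{}"] by (auto simp: C_def)
  moreover have "f {\<omega>. \<omega> n \<in> B} = measure (\<mu> n) B" if "B \<in> sets borel" for n B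
    using X[of "{n}" "{B}"] that by (auto simp: C_def)
  moreover have "f {\<omega>. \<exists>I\<in>\<I>. \<omega> i \<in> I \<and> \<omega> j \<notin> I} \<le> F j - F i"
    if "key i < key j" "finite \<I>" "\<I> \<subseteq> increasing_sets" for i j \<I>
  proof -
    have "\<I> \<inter> increasing_sets = \<I>" "\<I> \<subseteq> sets borel" using that by (auto simp: increasing_sets_def)
    then show ?thesis using X[of "{i, j}" \<I>] that by (simp add: C_def)
  qed
  moreover have "0 \<le> f A" for A using f(1) by (auto simp: K_def)
  ultimately show ?thesis by blast
qed

end

section \<open>Countable additivity on sequence space\<close>

lemma compact_inner_approximation:
  fixes M :: "'a::polish_space measure"
  assumes "prob_space M" and sets: "sets M = sets borel" and B: "B \<in> sets borel" and "0 < \<eta>"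
  shows "\<exists>K. compact K \<and> K \<subseteq> B \<and> measure M (B - K) < \<eta>"
proof (cases "measure M B < \<eta>")
  case True
  then show ?thesis by (intro exI[of _ "{}"]) simp
next
  case False
  interpret prob_space M by fact
  have "ennreal (measure M B - \<eta>) < emeasure M B"
    using False \<open>0 < \<eta>\<close> by (simp add: emeasure_eq_measure ennreal_less_iff)
  also have "emeasure M B = (SUP K \<in> {K. K \<subseteq> B \<and> compact K}. emeasure M K)"
    using inner_regular[OF sets _ B] by simp
  finally obtain K where K: "K \<subseteq> B" "compact K" "ennreal (measure M B - \<eta>) < emeasure M K"
    by (auto simp: less_SUP_iff)
  have "K \<in> sets M" using K(2) sets by (simp add: borel_compact)
  then have "measure M (B - K) = measure M B - measure M K"
    using K(1) B sets by (intro finite_measure_Diff) auto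
  moreover have "measure M B - \<eta> < measure M K"
    using K(3) False by (simp add: emeasure_eq_measure ennreal_less_iff)
  ultimately show ?thesis using K by (intro exI[of _ K]) simp
qed

text \<open>
  Finite additivity upgrades to countable additivity because all marginals are tight. On the algebra
  of sets that can be squeezed between a closed and an open set, both depending on finitely many
  coordinates, the members of a decreasing sequence of sets of mass at least \<open>\<delta>\<close> contain closed
  sets whose finite intersections meet one fixed product of compact sets; hence all of them
  have a common point. Caratheodory's theorem applies.
\<close>

lemma coordinate_process_exists:
  fixes f :: "(nat \<Rightarrow> 'a::polish_space) set \<Rightarrow> real" and \<mu> :: "nat \<Rightarrow> 'a measure"
  assumes f_nonneg: "\<And>A. 0 \<le> f A" and f_UNIV: "f UNIV = 1"
    and f_add: "\<And>A B. A \<inter> B = {} \<Longrightarrow> f (A \<union> B) = f A + f B"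
    and prob: "\<And>n. prob_space (\<mu> n)" and sets_\<mu>: "\<And>n. sets (\<mu> n) = sets borel"
    and marginal: "\<And>n B. B \<in> sets borel \<Longrightarrow> f {\<omega>. \<omega> n \<in> B} = measure (\<mu> n) B"
  shows "\<exists>M \<G>. prob_space M \<and> algebra UNIV \<G> \<and> sets M = sigma_sets UNIV \<G> \<and>
    (\<forall>n. \<forall>B\<in>sets borel. {\<omega>. \<omega> n \<in> B} \<in> \<G>) \<and> (\<forall>G\<in>\<G>. measure M G = f G)"
proof -
  have f_empty: "f {} = 0" using f_add[of "{}" "{}"] by simp
  have f_mono: "f A \<le> f B" if "A \<subseteq> B" for A B
  proof -
    have "f (A \<union> (B - A)) = f A + f (B - A)" by (rule f_add) blast
    moreover have "A \<union> (B - A) = B" using that by blast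
    ultimately show ?thesis using f_nonneg[of "B - A"] by simp
  qed
  have f_subadd: "f (A \<union> B) \<le> f A + f B" for A B
  proof -
    have "f (A \<union> (B - A)) = f A + f (B - A)" by (rule f_add) blast
    moreover have "f (B - A) \<le> f B" by (rule f_mono) blast
    ultimately show ?thesis by simp
  qed
  have f_subadd_UN: "f (\<Union>i\<in>I. A i) \<le> (\<Sum>i\<in>I. f (A i))" if "finite I" for A and I :: "nat set"
    using that
  proof induction
    case (insert i I)
    then show ?case using f_subadd[of "A i" "\<Union>i\<in>I. A i"] by simp
  qed (simp add: f_empty)
  define depends where
    "depends m C \<longleftrightarrow> (\<forall>\<omega> \<omega>'. (\<forall>i<m. \<omega> i = \<omega>' i) \<longrightarrow> \<omega> \<in> C \<longrightarrow> \<omega>' \<in> C)" for m :: nat and C :: "(nat \<Rightarrow> 'a) set"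
  have depends_mono: "depends m' C" if "depends m C" "m \<le> m'" for m m' C
    using that unfolding depends_def by (meson less_le_trans)
  have depends_compl: "depends m (- C)" if "depends m C" for m C
    using that unfolding depends_def by (metis ComplD ComplI)
  have depends_Un: "depends (max m m') (C \<union> C')" if "depends m C" "depends m' C'" for m m' C C'
  proof -
    have "depends (max m m') C" "depends (max m m') C'"
      using that depends_mono by (meson max.cobounded1 max.cobounded2)+
    then show ?thesis unfolding depends_def by blast
  qed
  define approx where "approx \<eta> G C O' m \<longleftrightarrow>
    closed C \<and> open O' \<and> C \<subseteq> G \<and> G \<subseteq> O' \<and> depends m C \<and> depends m O' \<and> f (O' - C) < \<eta>"
    for \<eta> G C O' m
  define \<G> where "\<G> = {G. \<forall>\<eta>>0. \<exists>C O' m. approx \<eta> G C O' m}"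
  have cylinder: "{\<omega>. \<omega> n \<in> B} \<in> \<G>" if B: "B \<in> sets borel" for n B
    unfolding \<G>_def
  proof (intro CollectI allI impI)
    fix \<eta> :: real assume "0 < \<eta>"
    obtain K where K: "compact K" "K \<subseteq> B" "measure (\<mu> n) (B - K) < \<eta> / 2"
      using compact_inner_approximation[OF prob sets_\<mu> B, of "\<eta> / 2"] \<open>0 < \<eta>\<close> by auto
    obtain L where L: "compact L" "L \<subseteq> - B" "measure (\<mu> n) (- B - L) < \<eta> / 2"
      using compact_inner_approximation[OF prob sets_\<mu>, of "- B" "\<eta> / 2"] B \<open>0 < \<eta>\<close> by auto
    let ?C = "{\<omega>. \<omega> n \<in> K}" and ?O = "{\<omega>. \<omega> n \<in> - L}"
    have "closed ((\<lambda>\<omega>. \<omega> n) -` K)"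
      using compact_imp_closed[OF K(1)] by (rule closed_vimage) (rule continuous_on_product_coordinates)
    then have "closed ?C" by (simp add: vimage_def)
    moreover have "open ((\<lambda>\<omega>. \<omega> n) -` (- L))"
      using compact_imp_closed[OF L(1), unfolded closed_def]
      by (rule open_vimage) (rule continuous_on_product_coordinates)
    then have "open ?O" by (simp add: vimage_def)
    moreover have "depends (Suc n) ?C" "depends (Suc n) ?O" unfolding depends_def by auto
    moreover have "f (?O - ?C) < \<eta>"
    proof -
      have "?O - ?C \<subseteq> {\<omega>. \<omega> n \<in> B - K} \<union> {\<omega>. \<omega> n \<in> - B - L}" by auto
      then have "f (?O - ?C) \<le> f {\<omega>. \<omega> n \<in> B - K} + f {\<omega>. \<omega> n \<in> - B - L}"
        using f_mono f_subadd by (meson order_trans)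
      also have "\<dots> = measure (\<mu> n) (B - K) + measure (\<mu> n) (- B - L)"
        using B K(1) L(1) borel_compact by (subst (1 2) marginal) auto
      finally show ?thesis using K(3) L(3) by simp
    qed
    ultimately have "approx \<eta> {\<omega>. \<omega> n \<in> B} ?C ?O (Suc n)"
      unfolding approx_def using K(2) L(2) by auto
    then show "\<exists>C O' m. approx \<eta> {\<omega>. \<omega> n \<in> B} C O' m" by blast
  qed
  interpret \<G>: algebra UNIV \<G>
  proof (rule algebra_iff_Un[THEN iffD2], intro conjI ballI)
    show "{} \<in> \<G>" using cylinder[of "{}"] by simp
  next
    fix G assume G: "G \<in> \<G>"
    show "UNIV - G \<in> \<G>"
      unfolding \<G>_def
    proof (intro CollectI allI impI)
      fix \<eta> :: real assume "0 < \<eta>"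
      then obtain C O' m where "approx \<eta> G C O' m" using G by (auto simp: \<G>_def)
      moreover have "- C - - O' = O' - C" by blast
      ultimately have "approx \<eta> (UNIV - G) (- O') (- C) m"
        using depends_compl by (auto simp: approx_def closed_def)
      then show "\<exists>C O' m. approx \<eta> (UNIV - G) C O' m" by blast
    qed
  next
    fix G G' assume G: "G \<in> \<G>" "G' \<in> \<G>"
    show "G \<union> G' \<in> \<G>"
      unfolding \<G>_def
    proof (intro CollectI allI impI)
      fix \<eta> :: real assume "0 < \<eta>"
      then have "0 < \<eta> / 2" by simp
      then obtain C O' m C' O'' m' where *: "approx (\<eta> / 2) G C O' m" "approx (\<eta> / 2) G' C' O'' m'"
        using G unfolding \<G>_def by blast
      have "f ((O' \<union> O'') - (C \<union> C')) \<le> f ((O' - C) \<union> (O'' - C'))" by (rule f_mono) blast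
      also have "\<dots> \<le> f (O' - C) + f (O'' - C')" by (rule f_subadd)
      finally have "f ((O' \<union> O'') - (C \<union> C')) < \<eta>" using * unfolding approx_def by linarith
      moreover have "closed (C \<union> C')" "open (O' \<union> O'')" "C \<union> C' \<subseteq> G \<union> G'" "G \<union> G' \<subseteq> O' \<union> O''"
        using * unfolding approx_def by auto
      moreover have "depends (max m m') (C \<union> C')" "depends (max m m') (O' \<union> O'')"
        using * depends_Un unfolding approx_def by simp_all
      ultimately have "approx \<eta> (G \<union> G') (C \<union> C') (O' \<union> O'') (max m m')"
        unfolding approx_def by blast
      then show "\<exists>C O' m. approx \<eta> (G \<union> G') C O' m" by blast
    qed
  qed simp
  have continuity: "(\<lambda>k. ennreal (f (A k))) \<longlonglongrightarrow> 0"
    if A: "range A \<subseteq> \<G>" and "decseq A" and empty: "(\<Inter>k. A k) = {}" for A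
  proof (rule ccontr)
    assume contr: "\<not> (\<lambda>k. ennreal (f (A k))) \<longlonglongrightarrow> 0"
    have dec: "f (A k) \<le> f (A l)" if "l \<le> k" for k l
      using that \<open>decseq A\<close> by (intro f_mono) (simp add: decseq_def)
    have "\<not> (\<lambda>k. f (A k)) \<longlonglongrightarrow> 0" using contr tendsto_ennrealI[of "\<lambda>k. f (A k)" 0] by auto
    then obtain \<delta> where \<delta>: "0 < \<delta>" "\<And>K. \<exists>k\<ge>K. \<delta> \<le> f (A k)"
      using f_nonneg by (auto simp: LIMSEQ_iff abs_of_nonneg not_less)
    then have lower: "\<delta> \<le> f (A k)" for k using dec by (meson order_trans)
    have "\<exists>C m. closed C \<and> C \<subseteq> A k \<and> depends m C \<and> f (A k - C) < \<delta> / 4 * (1 / 2) ^ k" for k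
    proof -
      have "0 < \<delta> / 4 * (1 / 2) ^ k" using \<delta>(1) by simp
      then obtain C O' m where *: "approx (\<delta> / 4 * (1 / 2) ^ k) (A k) C O' m"
        using A unfolding \<G>_def by blast
      then have "f (A k - C) \<le> f (O' - C)" by (intro f_mono) (auto simp: approx_def)
      then show ?thesis using * unfolding approx_def by fastforce
    qed
    then obtain C m where C: "\<And>k. closed (C k)" "\<And>k. C k \<subseteq> A k" "\<And>k. depends (m k) (C k)"
        "\<And>k. f (A k - C k) < \<delta> / 4 * (1 / 2) ^ k"
      by metis
    have "\<exists>K. compact K \<and> K \<subseteq> UNIV \<and> measure (\<mu> n) (UNIV - K) < \<delta> / 4 * (1 / 2) ^ n" for n
      using \<delta>(1) by (intro compact_inner_approximation prob sets_\<mu>) auto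
    then obtain K where K: "\<And>n. compact (K n)" "\<And>n. measure (\<mu> n) (- K n) < \<delta> / 4 * (1 / 2) ^ n"
      unfolding Compl_eq_Diff_UNIV by metis
    have geometric: "(\<Sum>i\<in>I. \<delta> / 4 * (1 / 2) ^ i) \<le> \<delta> / 2" if "finite I" for I :: "nat set"
    proof -
      have "(\<Sum>i\<in>I. \<delta> / 4 * (1 / 2) ^ i) \<le> (\<Sum>i. \<delta> / 4 * (1 / 2) ^ i)"
        using \<delta>(1) that by (intro sum_le_suminf summable_mult summable_geometric) auto
      also have "\<dots> = \<delta> / 2"
        by (subst suminf_mult) (auto simp: suminf_geometric)
      finally show ?thesis .
    qed
    define \<K> where "\<K> = PiE UNIV K"
    have "compact \<K>"
      unfolding \<K>_def using compactin_PiE[of "\<lambda>_. euclidean" UNIV K] K(1)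
      by (simp add: euclidean_product_topology)
    have "\<K> \<inter> (\<Inter>k\<in>UNIV. C k) \<noteq> {}"
    proof (rule compact_imp_fip_image[OF \<open>compact \<K>\<close>])
      fix I :: "nat set" assume "finite I"
      define n where "n = Max (insert 0 I)"
      have n: "k \<le> n" if "k \<in> I" for k using \<open>finite I\<close> that unfolding n_def by simp
      define l where "l = Max (m ` {..n})"
      have l: "m k \<le> l" if "k \<le> n" for k using that unfolding l_def by simp
      define E where "E = (\<Inter>k\<in>{..n}. C k) \<inter> {\<omega>. \<forall>i<l. \<omega> i \<in> K i}"
      have "f (\<Union>k\<in>{..n}. A k - C k) \<le> (\<Sum>k\<in>{..n}. f (A k - C k))" by (rule f_subadd_UN) simp
      also have "\<dots> < (\<Sum>k\<in>{..n}. \<delta> / 4 * (1 / 2) ^ k)" using C(4) by (intro sum_strict_mono) auto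
      also have "\<dots> \<le> \<delta> / 2" by (rule geometric) simp
      finally have loss_C: "f (\<Union>k\<in>{..n}. A k - C k) < \<delta> / 2" .
      have "f (\<Union>i\<in>{..<l}. {\<omega>. \<omega> i \<in> - K i}) \<le> (\<Sum>i\<in>{..<l}. f {\<omega>. \<omega> i \<in> - K i})"
        by (rule f_subadd_UN) simp
      also have "\<dots> = (\<Sum>i\<in>{..<l}. measure (\<mu> i) (- K i))"
        using K(1) by (intro sum.cong refl marginal) (simp add: borel_compact borel_comp)
      also have "\<dots> \<le> (\<Sum>i\<in>{..<l}. \<delta> / 4 * (1 / 2) ^ i)"
        using K(2) by (intro sum_mono less_imp_le)
      also have "\<dots> \<le> \<delta> / 2" by (rule geometric) simp
      finally have loss_K: "f (\<Union>i\<in>{..<l}. {\<omega>. \<omega> i \<in> - K i}) \<le> \<delta> / 2" .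
      have "A n \<subseteq> E \<union> (\<Union>k\<in>{..n}. A k - C k) \<union> (\<Union>i\<in>{..<l}. {\<omega>. \<omega> i \<in> - K i})"
      proof -
        have "A n \<subseteq> A k" if "k \<le> n" for k using \<open>decseq A\<close> that by (simp add: decseq_def)
        then show ?thesis unfolding E_def by auto
      qed
      then have "f (A n) \<le> f E + f (\<Union>k\<in>{..n}. A k - C k) + f (\<Union>i\<in>{..<l}. {\<omega>. \<omega> i \<in> - K i})"
        using f_mono f_subadd by (smt (verit, best))
      then have "0 < f E" using lower[of n] loss_C loss_K by linarith
      then obtain \<omega> where \<omega>: "\<omega> \<in> E" using f_empty by fastforce
      have "K i \<noteq> {}" for i
      proof
        assume "K i = {}"
        then have "measure (\<mu> i) UNIV < \<delta> / 4 * (1 / 2) ^ i" using K(2)[of i] by simp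
        moreover have "\<delta> / 4 * (1 / 2) ^ i \<le> \<delta> / 4 * 1"
          using \<delta>(1) by (intro mult_left_mono power_le_one) auto
        moreover have "\<delta> \<le> 1" using lower[of 0] f_mono[of "A 0" UNIV] f_UNIV by simp
        moreover have "measure (\<mu> i) UNIV = 1"
          using prob_space.prob_space[OF prob] sets_eq_imp_space_eq[OF sets_\<mu>] by (metis space_borel)
        ultimately show False by simp
      qed
      then have "\<exists>x. x \<in> K i" for i by blast
      then obtain z where z: "\<And>i. z i \<in> K i" by metis
      \<comment> \<open>Tightness is only used for the coordinates below \<open>l\<close>; the others do not affect
        membership in \<open>C k\<close> and are moved into the compact sets.\<close>
      define \<omega>' where "\<omega>' i = (if i < l then \<omega> i else z i)" for i
      have "\<omega>' \<in> \<K>" using \<omega> z by (auto simp: \<K>_def E_def \<omega>'_def PiE_UNIV_domain)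
      moreover have "\<omega>' \<in> C k" if "k \<in> I" for k
      proof -
        have "\<omega> \<in> C k" using \<omega> n[OF that] by (simp add: E_def)
        moreover have "\<forall>i<m k. \<omega> i = \<omega>' i" using l[OF n[OF that]] by (auto simp: \<omega>'_def)
        ultimately show ?thesis using C(3)[of k] unfolding depends_def by blast
      qed
      ultimately show "\<K> \<inter> (\<Inter>k\<in>I. C k) \<noteq> {}" by blast
    qed (rule C(1))
    then obtain \<omega> where "\<And>k. \<omega> \<in> C k" by blast
    then have "\<omega> \<in> (\<Inter>k. A k)" using C(2) by blast
    then show False using empty by blast
  qed
  have "positive \<G> (\<lambda>A. ennreal (f A))" by (simp add: positive_def f_empty)
  moreover have "additive \<G> (\<lambda>A. ennreal (f A))"
    using f_nonneg by (simp add: additive_def f_add)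
  ultimately have "\<exists>\<nu>. (\<forall>s\<in>\<G>. \<nu> s = ennreal (f s)) \<and> measure_space UNIV (sigma_sets UNIV \<G>) \<nu>"
    by (rule \<G>.caratheodory_empty_continuous) (simp, rule continuity)
  then obtain \<nu> where \<nu>: "\<forall>s\<in>\<G>. \<nu> s = ennreal (f s)" "measure_space UNIV (sigma_sets UNIV \<G>) \<nu>"
    by blast
  define M where "M = measure_of UNIV \<G> \<nu>"
  have sets_M: "sets M = sigma_sets UNIV \<G>" unfolding M_def by (simp add: sets_measure_of)
  have emeasure_M: "emeasure M G = ennreal (f G)" if "G \<in> \<G>" for G
  proof -
    have "emeasure M G = \<nu> G"
    proof (rule emeasure_measure_of[OF M_def])
      show "positive (sets M) \<nu>" "countably_additive (sets M) \<nu>"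
        using \<nu>(2) unfolding sets_M measure_space_def by simp_all
      show "G \<in> sets M" unfolding sets_M using that by (rule sigma_sets.Basic)
    qed simp
    then show ?thesis using \<nu>(1) that by simp
  qed
  have "prob_space M"
  proof
    have "space M = UNIV" unfolding M_def by (simp add: space_measure_of)
    then show "emeasure M (space M) = 1" using emeasure_M[OF \<G>.top] f_UNIV by simp
  qed
  moreover have "measure M G = f G" if "G \<in> \<G>" for G
    using emeasure_M[OF that] f_nonneg by (simp add: measure_def)
  ultimately show ?thesis using sets_M cylinder \<G>.algebra_axioms by blast
qed

section \<open>Monotone couplings on ordered Polish spaces\<close>

lemma UNIV_increasing [simp]: "UNIV \<in> increasing_sets"
  by (simp add: increasing_sets_def)

lemma increasing_sets_borel: "I \<in> increasing_sets \<Longrightarrow> I \<in> sets borel"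
  by (simp add: increasing_sets_def)

lemma sets_Collect_le_closed_order:
  fixes X Y :: "'w \<Rightarrow> 'a::{polish_space, order}"
  assumes "closed {(x::'a, y). x \<le> y}" and "X \<in> borel_measurable M" "Y \<in> borel_measurable M"
  shows "{\<omega> \<in> space M. X \<omega> \<le> Y \<omega>} \<in> sets M"
proof -
  have "(\<lambda>\<omega>. (X \<omega>, Y \<omega>)) \<in> borel_measurable M"
    using assms(2,3) by (rule borel_measurable_Pair)
  from measurable_sets[OF this borel_closed[OF assms(1)]]
  show ?thesis by (simp add: vimage_def Int_def conj_commute)
qed

lemma closed_up_closure_compact:
  fixes K :: "'a::{polish_space, order} set"
  assumes closed_order: "closed {(x::'a, y). x \<le> y}" and "compact K"
  shows "closed {y. \<exists>x\<in>K. x \<le> y}"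
proof (unfold closed_sequential_limits, intro allI impI, elim conjE)
  fix s :: "nat \<Rightarrow> 'a" and y assume s: "\<forall>n. s n \<in> {y. \<exists>x\<in>K. x \<le> y}" "s \<longlonglongrightarrow> y"
  then obtain t where t: "\<And>n. t n \<in> K" "\<And>n. t n \<le> s n" by (simp add: Bex_def) metis
  obtain x r where x: "x \<in> K" "strict_mono r" "(t \<circ> r) \<longlonglongrightarrow> x"
    using \<open>compact K\<close> t(1) unfolding compact_eq_seq_compact_metric seq_compact_def by metis
  have lim: "(\<lambda>n. ((t \<circ> r) n, (s \<circ> r) n)) \<longlonglongrightarrow> (x, y)"
    by (intro tendsto_Pair x(3) LIMSEQ_subseq_LIMSEQ[OF s(2) x(2)])
  have "((t \<circ> r) n, (s \<circ> r) n) \<in> {(x, y). x \<le> y}" for n using t(2) by simp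
  then have "(x, y) \<in> {(x, y). x \<le> y}"
    by (rule closed_sequentially[OF closed_order _ lim])
  then show "y \<in> {y. \<exists>x\<in>K. x \<le> y}" using x(1) by blast
qed

text \<open>
  Up to small probability, countably many increasing sets detect that \<open>X \<le> Y\<close> fails: if \<open>X\<close> lies
  in a compact set \<open>L\<close>, the up-closures of \<open>closure U \<inter> L\<close> for basic open \<open>U\<close> are closed increasing
  sets, and \<open>X \<le> Y\<close> can only fail if one of them contains \<open>X\<close> but not \<open>Y\<close>. Intersecting with \<open>L\<close>
  is what makes the up-closures closed.
\<close>

lemma prob_not_le_bound:
  fixes X Y :: "'w \<Rightarrow> 'a::{polish_space, order}"
  assumes closed_order: "closed {(x::'a, y). x \<le> y}" and "prob_space M"
    and X[measurable]: "X \<in> borel_measurable M" and Y[measurable]: "Y \<in> borel_measurable M"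
    and crossing: "\<And>\<I>. finite \<I> \<Longrightarrow> \<I> \<subseteq> increasing_sets \<Longrightarrow>
      measure M {\<omega> \<in> space M. \<exists>I\<in>\<I>. X \<omega> \<in> I \<and> Y \<omega> \<notin> I} \<le> \<eta>"
  shows "measure M {\<omega> \<in> space M. \<not> X \<omega> \<le> Y \<omega>} \<le> \<eta>"
proof (rule field_le_epsilon)
  fix \<delta> :: real assume "0 < \<delta>"
  interpret prob_space M by fact
  interpret X: prob_space "distr M borel X" by (rule prob_space_distr) (rule X)
  obtain L where L: "compact L" "measure (distr M borel X) (UNIV - L) < \<delta>"
    using compact_inner_approximation[OF X.prob_space_axioms _ _ \<open>0 < \<delta>\<close>, of UNIV] by auto
  have L_borel[measurable]: "L \<in> sets borel" using L(1) by (rule borel_compact)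
  have far: "measure M {\<omega> \<in> space M. X \<omega> \<notin> L} < \<delta>"
    using L(2) L_borel X
    by (subst (asm) measure_distr) (auto simp: vimage_def Int_def conj_commute)
  obtain \<U> :: "'a set set" where \<U>: "countable \<U>" "topological_basis \<U>"
    using ex_countable_basis by blast
  define up where "up U = {y. \<exists>x\<in>closure U \<inter> L. x \<le> y}" for U
  have up_inc: "up U \<in> increasing_sets" for U
  proof -
    have "closed (up U)"
      unfolding up_def using L(1) closed_order
      by (intro closed_up_closure_compact closed_Int_compact) auto
    then show ?thesis unfolding increasing_sets_def up_def
      by (auto intro: borel_closed order_trans)
  qed
  define \<J> where "\<J> = insert UNIV (up ` \<U>)"
  have \<J>: "countable \<J>" "\<J> \<noteq> {}" "\<J> \<subseteq> increasing_sets"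
    using \<U>(1) up_inc by (auto simp: \<J>_def)
  define J where "J = from_nat_into \<J>"
  have range_J: "range J = \<J>" unfolding J_def using \<J> by (simp add: range_from_nat_into)
  have J_inc: "J k \<in> increasing_sets" for k using range_J \<J>(3) by blast
  have [measurable]: "J k \<in> sets borel" for k using J_inc by (rule increasing_sets_borel)
  define E where "E n = {\<omega> \<in> space M. \<exists>I\<in>J ` {..<n}. X \<omega> \<in> I \<and> Y \<omega> \<notin> I}" for n
  have E_sets: "E n \<in> sets M" for n
  proof -
    have "E n = {\<omega> \<in> space M. \<exists>k\<in>{..<n}. X \<omega> \<in> J k \<and> Y \<omega> \<notin> J k}" by (auto simp: E_def)
    also have "\<dots> \<in> sets M" by measurable
    finally show ?thesis .
  qed
  have "incseq E" by (intro incseq_SucI) (auto simp: E_def less_Suc_eq)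
  then have "(\<lambda>n. measure M (E n)) \<longlonglongrightarrow> measure M (\<Union>n. E n)"
    using E_sets by (intro finite_Lim_measure_incseq) auto
  moreover have "measure M (E n) \<le> \<eta>" for n
    unfolding E_def using J_inc by (intro crossing) auto
  ultimately have E_le: "measure M (\<Union>n. E n) \<le> \<eta>" by (intro LIMSEQ_le_const2) auto
  have "{\<omega> \<in> space M. \<not> X \<omega> \<le> Y \<omega>} \<subseteq> (\<Union>n. E n) \<union> {\<omega> \<in> space M. X \<omega> \<notin> L}"
  proof
    fix \<omega> assume \<omega>: "\<omega> \<in> {\<omega> \<in> space M. \<not> X \<omega> \<le> Y \<omega>}"
    have "open (- {(x::'a, y). x \<le> y})" using closed_order by (simp add: closed_def)
    moreover have "(X \<omega>, Y \<omega>) \<in> - {(x, y). x \<le> y}" using \<omega> by simp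
    ultimately obtain A B where AB: "open A" "open B" "(X \<omega>, Y \<omega>) \<in> A \<times> B"
        "A \<times> B \<subseteq> - {(x, y). x \<le> y}"
      by (rule open_prod_elim)
    then obtain e where e: "0 < e" "cball (X \<omega>) e \<subseteq> A"
      using open_contains_cball by (metis mem_Times_iff fst_conv)
    obtain U where U: "U \<in> \<U>" "X \<omega> \<in> U" "U \<subseteq> ball (X \<omega>) e"
      using topological_basisE[OF \<U>(2), of "ball (X \<omega>) e" "X \<omega>"] e(1) by auto
    have "closure U \<subseteq> A"
      using U(3) e(2) by (meson ball_subset_cball closed_cball closure_minimal order_trans)
    then have "Y \<omega> \<notin> up U" using AB(3,4) unfolding up_def by auto
    moreover have "X \<omega> \<in> up U" if "X \<omega> \<in> L"
      using that U(2) closure_subset unfolding up_def by blast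
    moreover obtain k where "up U = J k" using U(1) range_J unfolding \<J>_def by blast
    ultimately have "X \<omega> \<in> L \<Longrightarrow> \<omega> \<in> E (Suc k)" using \<omega> by (auto simp: E_def)
    then show "\<omega> \<in> (\<Union>n. E n) \<union> {\<omega> \<in> space M. X \<omega> \<notin> L}" using \<omega> by blast
  qed
  then have "measure M {\<omega> \<in> space M. \<not> X \<omega> \<le> Y \<omega>} \<le>
      measure M ((\<Union>n. E n) \<union> {\<omega> \<in> space M. X \<omega> \<notin> L})"
    using E_sets by (intro finite_measure_mono) auto
  also have "\<dots> \<le> measure M (\<Union>n. E n) + measure M {\<omega> \<in> space M. X \<omega> \<notin> L}"
    using E_sets by (intro measure_Un_le) auto
  finally show "measure M {\<omega> \<in> space M. \<not> X \<omega> \<le> Y \<omega>} \<le> \<eta> + \<delta>"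
    using E_le far by simp
qed

context dominated_family
begin

text \<open>
  A version of Strassen's theorem. The finitely additive coupling already satisfies every marginal
  and order requirement that a finite family of increasing sets can express.
\<close>

theorem monotone_coupling:
  assumes closed_order: "closed {(x::'a, y). x \<le> y}"
  shows "\<exists>M::(nat \<Rightarrow> 'a) measure. prob_space M \<and> (\<forall>n. (\<lambda>\<omega>. \<omega> n) \<in> borel_measurable M) \<and>
    (\<forall>n. distr M borel (\<lambda>\<omega>. \<omega> n) = \<mu> n) \<and>
    (\<forall>i j. key i < key j \<longrightarrow> measure M {\<omega> \<in> space M. \<not> \<omega> i \<le> \<omega> j} \<le> F j - F i)"
proof -
  obtain f :: "(nat \<Rightarrow> 'a) set \<Rightarrow> real" where f: "\<And>A. 0 \<le> f A" "f UNIV = 1"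
      "\<And>A B. A \<inter> B = {} \<Longrightarrow> f (A \<union> B) = f A + f B"
      "\<And>n B. B \<in> sets borel \<Longrightarrow> f {\<omega>. \<omega> n \<in> B} = measure (\<mu> n) B"
      "\<And>i j \<I>. key i < key j \<Longrightarrow> finite \<I> \<Longrightarrow> \<I> \<subseteq> increasing_sets \<Longrightarrow>
        f {\<omega>. \<exists>I\<in>\<I>. \<omega> i \<in> I \<and> \<omega> j \<notin> I} \<le> F j - F i"
    using finitely_additive_coupling by blast
  obtain M \<G> where M: "prob_space M" "algebra UNIV \<G>" "sets M = sigma_sets UNIV \<G>"
      "\<And>n B. B \<in> sets borel \<Longrightarrow> {\<omega>. \<omega> n \<in> B} \<in> \<G>" "\<And>G. G \<in> \<G> \<Longrightarrow> measure M G = f G"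
    using coordinate_process_exists[of f \<mu>, OF f(1-3) prob sets_\<mu> f(4)] by metis
  interpret \<G>: algebra UNIV \<G> by fact
  interpret M: prob_space M by fact
  have space_M: "space M = UNIV"
  proof -
    have "UNIV \<in> sets M" unfolding M(3) by (intro sigma_sets.Basic \<G>.top)
    then show ?thesis using sets.sets_into_space by blast
  qed
  have cylinder: "{\<omega>. \<omega> n \<in> B} \<in> sets M" if "B \<in> sets borel" for n B
    unfolding M(3) using M(4)[OF that] by (rule sigma_sets.Basic)
  have coord: "(\<lambda>\<omega>. \<omega> n) \<in> borel_measurable M" for n
    using cylinder by (intro measurableI) (auto simp: space_M vimage_def)
  moreover have "distr M borel (\<lambda>\<omega>. \<omega> n) = \<mu> n" for n
  proof (rule measure_eqI)
    fix B assume "B \<in> sets (distr M borel (\<lambda>\<omega>. \<omega> n))"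
    then have B: "B \<in> sets borel" by simp
    interpret n: prob_space "\<mu> n" by (rule prob)
    have "emeasure (distr M borel (\<lambda>\<omega>. \<omega> n)) B = emeasure M {\<omega>. \<omega> n \<in> B}"
      using coord B by (subst emeasure_distr) (auto simp: space_M vimage_def)
    also have "\<dots> = emeasure (\<mu> n) B"
      unfolding M.emeasure_eq_measure n.emeasure_eq_measure using M(4,5) B f(4) by simp
    finally show "emeasure (distr M borel (\<lambda>\<omega>. \<omega> n)) B = emeasure (\<mu> n) B" .
  qed (simp add: sets_\<mu>)
  moreover have "measure M {\<omega> \<in> space M. \<not> \<omega> i \<le> \<omega> j} \<le> F j - F i" if less: "key i < key j" for i j
  proof (rule prob_not_le_bound[OF closed_order M(1) coord coord])
    fix \<I> :: "'a set set" assume \<I>: "finite \<I>" "\<I> \<subseteq> increasing_sets"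
    have "{\<omega>. \<exists>I\<in>\<I>. \<omega> i \<in> I \<and> \<omega> j \<notin> I} = (\<Union>I\<in>\<I>. {\<omega>. \<omega> i \<in> I} \<inter> {\<omega>. \<omega> j \<in> - I})" by auto
    also have "\<dots> \<in> \<G>"
      using \<I> by (intro \<G>.finite_UN \<G>.Int M(4)) (auto intro: increasing_sets_borel borel_comp)
    finally show "measure M {\<omega> \<in> space M. \<exists>I\<in>\<I>. \<omega> i \<in> I \<and> \<omega> j \<notin> I} \<le> F j - F i"
      using f(5)[OF less \<I>] M(5) by (simp add: space_M)
  qed
  ultimately show ?thesis using M(1) by (intro exI[of _ M]) simp
qed

end

text \<open>
  Couple the two laws so that \<open>\<omega> 0 \<le> \<omega> 1\<close>. For every increasing \<open>I\<close> the event \<open>\<omega> 0 \<in> I\<close>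
  is contained in \<open>\<omega> 1 \<in> I\<close> and has the same probability, so the latter without the former is
  null; hence also \<open>\<omega> 1 \<le> \<omega> 0\<close>, and the two coordinates agree.
\<close>

lemma increasing_sets_determine_measure:
  fixes \<mu> \<nu> :: "'a::{polish_space, order} measure"
  assumes closed_order: "closed {(x::'a, y). x \<le> y}"
    and prob: "prob_space \<mu>" "prob_space \<nu>" and sets: "sets \<mu> = sets borel" "sets \<nu> = sets borel"
    and eq: "\<And>I. I \<in> increasing_sets \<Longrightarrow> measure \<mu> I = measure \<nu> I"
  shows "\<mu> = \<nu>"
proof -
  define law where "law n = (if n = 0 then \<mu> else \<nu>)" for n :: nat
  interpret dominated_family law real "\<lambda>_. 0"
    by (rule dominated_family.intro) (simp_all add: law_def prob sets eq inj_on_def)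
  obtain M :: "(nat \<Rightarrow> 'a) measure" where coupling: "prob_space M"
      "\<forall>n. (\<lambda>\<omega>. \<omega> n) \<in> borel_measurable M" "\<forall>n. distr M borel (\<lambda>\<omega>. \<omega> n) = law n"
      "\<forall>i j. real i < real j \<longrightarrow> measure M {\<omega> \<in> space M. \<not> \<omega> i \<le> \<omega> j} \<le> 0 - 0"
    using monotone_coupling[OF closed_order] by (elim exE conjE)
  note M = coupling(1) coupling(2)[rule_format] coupling(3)[rule_format]
  have "measure M {\<omega> \<in> space M. \<not> \<omega> 0 \<le> \<omega> 1} \<le> 0" using coupling(4)[rule_format, of 0 1] by simp
  note M = M this
  interpret M: prob_space M by fact
  have le_sets: "{\<omega> \<in> space M. \<omega> i \<le> \<omega> j} \<in> sets M" for i j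
    by (rule sets_Collect_le_closed_order[OF closed_order M(2) M(2)])
  have AE_le: "AE \<omega> in M. \<omega> i \<le> \<omega> j"
    if "measure M {\<omega> \<in> space M. \<not> \<omega> i \<le> \<omega> j} \<le> 0" for i j
  proof (rule AE_I[OF order_refl])
    show "emeasure M {\<omega> \<in> space M. \<not> \<omega> i \<le> \<omega> j} = 0"
      using that measure_nonneg[of M] by (simp add: M.emeasure_eq_measure ennreal_eq_0_iff)
    show "{\<omega> \<in> space M. \<not> \<omega> i \<le> \<omega> j} \<in> sets M" using le_sets by (rule sets.sets_Collect_neg)
  qed
  have up: "AE \<omega> in M. \<omega> 0 \<le> \<omega> 1" using M(4) by (rule AE_le)
  have "measure M {\<omega> \<in> space M. \<not> \<omega> 1 \<le> \<omega> 0} \<le> 0"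
  proof (rule prob_not_le_bound[OF closed_order M(1) M(2) M(2)])
    fix \<I> :: "'a set set" assume \<I>: "finite \<I>" "\<I> \<subseteq> increasing_sets"
    have cross: "{\<omega> \<in> space M. \<omega> 1 \<in> I \<and> \<omega> 0 \<notin> I} \<in> null_sets M" if "I \<in> \<I>" for I
    proof -
      have I: "I \<in> increasing_sets" "I \<in> sets borel"
        using that \<I>(2) by (auto intro: increasing_sets_borel)
      have mem: "{\<omega> \<in> space M. \<omega> n \<in> I} \<in> sets M" for n
        using measurable_sets[OF M(2) I(2), of n] by (simp add: vimage_def Int_def conj_commute)
      have law_I: "measure M {\<omega> \<in> space M. \<omega> n \<in> I} = measure (law n) I" for n
        using M(2) I(2) by (simp add: M(3)[symmetric] measure_distr vimage_def Int_def conj_commute)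
      have "measure M ({\<omega> \<in> space M. \<omega> 1 \<in> I} - {\<omega> \<in> space M. \<omega> 0 \<in> I}) =
          measure M {\<omega> \<in> space M. \<omega> 1 \<in> I} - measure M ({\<omega> \<in> space M. \<omega> 1 \<in> I} \<inter> {\<omega> \<in> space M. \<omega> 0 \<in> I})"
        using mem by (intro M.finite_measure_Diff') auto
      also have "measure M ({\<omega> \<in> space M. \<omega> 1 \<in> I} \<inter> {\<omega> \<in> space M. \<omega> 0 \<in> I}) =
          measure M {\<omega> \<in> space M. \<omega> 0 \<in> I}"
        using up mem I(1) by (intro M.finite_measure_eq_AE) (auto simp: increasing_sets_def)
      finally have "measure M ({\<omega> \<in> space M. \<omega> 1 \<in> I} - {\<omega> \<in> space M. \<omega> 0 \<in> I}) = 0"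
        using eq[OF I(1)] by (simp add: law_I) (simp add: law_def)
      moreover have "{\<omega> \<in> space M. \<omega> 1 \<in> I} - {\<omega> \<in> space M. \<omega> 0 \<in> I} =
          {\<omega> \<in> space M. \<omega> 1 \<in> I \<and> \<omega> 0 \<notin> I}" by blast
      ultimately show ?thesis
        using sets.Diff[OF mem[of 1] mem[of 0]] by (auto simp: null_sets_def M.emeasure_eq_measure)
    qed
    have "(\<Union>I\<in>\<I>. {\<omega> \<in> space M. \<omega> 1 \<in> I \<and> \<omega> 0 \<notin> I}) \<in> null_sets M"
      using \<I>(1) cross by (intro null_sets.finite_UN) auto
    moreover have "(\<Union>I\<in>\<I>. {\<omega> \<in> space M. \<omega> 1 \<in> I \<and> \<omega> 0 \<notin> I}) =
        {\<omega> \<in> space M. \<exists>I\<in>\<I>. \<omega> 1 \<in> I \<and> \<omega> 0 \<notin> I}" by blast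
    ultimately show "measure M {\<omega> \<in> space M. \<exists>I\<in>\<I>. \<omega> 1 \<in> I \<and> \<omega> 0 \<notin> I} \<le> 0"
      by (simp add: measure_def null_sets_def)
  qed
  then have "AE \<omega> in M. \<omega> 1 \<le> \<omega> 0" by (rule AE_le)
  with up have "AE \<omega> in M. \<omega> 0 = \<omega> 1" by eventually_elim simp
  then have "distr M borel (\<lambda>\<omega>. \<omega> 0) = distr M borel (\<lambda>\<omega>. \<omega> 1)"
    using M(2) by (intro distr_cong_AE) auto
  then show ?thesis unfolding M(3) by (simp add: law_def)
qed

section \<open>Limits with respect to increasing sets\<close>

lemma closed_order_LIMSEQ_le:
  fixes s t :: "nat \<Rightarrow> 'a::{polish_space, order}"
  assumes "closed {(x::'a, y). x \<le> y}" and "s \<longlonglongrightarrow> a" "t \<longlonglongrightarrow> b" and "\<And>n. s n \<le> t n"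
  shows "a \<le> b"
proof -
  have lim: "(\<lambda>n. (s n, t n)) \<longlonglongrightarrow> (a, b)" using assms(2,3) by (rule tendsto_Pair)
  have "(s n, t n) \<in> {(x, y). x \<le> y}" for n using assms(4) by simp
  then have "(a, b) \<in> {(x, y). x \<le> y}"
    by (rule closed_sequentially[OF assms(1) _ lim])
  then show ?thesis by simp
qed

text \<open>
  From some index on, \<open>Y\<close> increases and stays below a fixed term of \<open>Z\<close>, so it has a limit;
  closedness of the order keeps this limit between \<open>Y\<close> and \<open>Z\<close>.
\<close>

lemma squeezed_sequence_converges:
  fixes Y Z :: "nat \<Rightarrow> 'a::{polish_space, order}"
  assumes closed_order: "closed {(x::'a, y). x \<le> y}"
    and BMC: "\<And>(s::nat \<Rightarrow> 'a) y. incseq s \<Longrightarrow> (\<And>n. s n \<le> y) \<Longrightarrow> convergent s"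
    and ev: "\<forall>\<^sub>F n in sequentially. Y n \<le> Y (Suc n) \<and> Y n \<le> Z n \<and> Z (Suc n) \<le> Z n"
  shows "\<exists>y. Y \<longlonglongrightarrow> y \<and> (\<forall>\<^sub>F n in sequentially. Y n \<le> y \<and> y \<le> Z n)"
proof -
  obtain m where m: "\<And>n. m \<le> n \<Longrightarrow> Y n \<le> Y (Suc n) \<and> Y n \<le> Z n \<and> Z (Suc n) \<le> Z n"
    using ev unfolding eventually_sequentially by blast
  have up: "Y n \<le> Y (k + n)" if "m \<le> n" for n k
  proof (induction k)
    case (Suc k)
    then show ?case using m[of "k + n"] that by (auto intro: order_trans)
  qed simp
  have down: "Z (k + n) \<le> Z n" if "m \<le> n" for n k
  proof (induction k)
    case (Suc k)
    then show ?case using m[of "k + n"] that by (auto intro: order_trans)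
  qed simp
  have between: "Y (k + n) \<le> Z n" if "m \<le> n" for n k
    using m[of "k + n"] down[OF that, of k] that by (auto intro: order_trans)
  have "incseq (\<lambda>k. Y (k + m))"
    using m by (intro incseq_SucI) simp
  then have "convergent (\<lambda>k. Y (k + m))" using between by (rule BMC) simp
  then obtain y where "(\<lambda>k. Y (k + m)) \<longlonglongrightarrow> y" by (auto simp: convergent_def)
  then have y: "Y \<longlonglongrightarrow> y" by (rule LIMSEQ_offset)
  have "Y n \<le> y \<and> y \<le> Z n" if "m \<le> n" for n
  proof
    show "Y n \<le> y"
      by (rule closed_order_LIMSEQ_le[OF closed_order tendsto_const LIMSEQ_ignore_initial_segment[OF y, of n]])
        (rule up[OF that])
    show "y \<le> Z n"
      by (rule closed_order_LIMSEQ_le[OF closed_order LIMSEQ_ignore_initial_segment[OF y, of n] tendsto_const])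
        (rule between[OF that])
  qed
  with y show ?thesis unfolding eventually_sequentially by blast
qed

text \<open>
  The coordinates \<open>2 n\<close> and \<open>2 n + 1\<close> both carry the law \<open>\<mu> n\<close>; they are the lower and the upper
  sequence. The error function \<open>F\<close> also serves as the key: it increases to \<open>0\<close> along the lower
  coordinates and decreases to \<open>0\<close> along the upper ones, so every lower index precedes every
  upper index.
\<close>

theorem increasing_Cauchy_limit_exists:
  fixes \<mu> :: "nat \<Rightarrow> 'a::{polish_space, order} measure" and r :: real
  assumes closed_order: "closed {(x::'a, y). x \<le> y}"
    and BMC: "\<And>(s::nat \<Rightarrow> 'a) y. incseq s \<Longrightarrow> (\<And>n. s n \<le> y) \<Longrightarrow> convergent s"
    and prob: "\<And>n. prob_space (\<mu> n)" and sets_\<mu>: "\<And>n. sets (\<mu> n) = sets borel"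
    and r: "0 < r" "r < 1"
    and Cauchy: "\<And>m n I. m \<le> n \<Longrightarrow> I \<in> increasing_sets \<Longrightarrow>
      \<bar>measure (\<mu> m) I - measure (\<mu> n) I\<bar> \<le> r ^ m"
  shows "\<exists>\<pi>. prob_space \<pi> \<and> sets \<pi> = sets borel \<and>
    (\<forall>g. g \<in> borel_measurable borel \<longrightarrow> range g \<subseteq> {0..1::real} \<longrightarrow> mono g \<longrightarrow>
      (\<lambda>n. \<integral>x. g x \<partial>\<mu> n) \<longlonglongrightarrow> (\<integral>x. g x \<partial>\<pi>))"
proof -
  \<comment> \<open>large enough for \<open>r ^ a + r ^ b \<le> C * (r ^ a - r ^ b)\<close> when \<open>a < b\<close>; the worst case is \<open>b = a + 1\<close>\<close>
  define C where "C = 2 / (1 - r)"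
  have C: "2 \<le> C" "C * (1 - r) = 2" using r by (simp_all add: C_def field_simps)
  define F where "F k = (if even k then - C * r ^ (k div 2) else C * r ^ (k div 2))" for k :: nat
  define law where "law k = \<mu> (k div 2)" for k
  have F_even: "F (2 * n) = - C * r ^ n" and F_odd: "F (Suc (2 * n)) = C * r ^ n" for n
    by (simp_all add: F_def)
  have gap: "r ^ a + r ^ b \<le> C * (r ^ a - r ^ b)" if "a < b" for a b
  proof -
    have "r ^ b \<le> r ^ Suc a" using that r by (intro power_decreasing) auto
    then have *: "r ^ b \<le> r * r ^ a" by simp
    then have "C * ((1 - r) * r ^ a) \<le> C * (r ^ a - r ^ b)"
      using C(1) by (intro mult_left_mono) (auto simp: algebra_simps)
    moreover have "C * ((1 - r) * r ^ a) = 2 * r ^ a" using C(2) by (simp add: mult.assoc[symmetric])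
    moreover have "r * r ^ a \<le> 1 * r ^ a" using r by (intro mult_right_mono) auto
    ultimately show ?thesis using * by linarith
  qed
  have power_less: "a < b" if "r ^ b < r ^ a" for a b :: nat
    using that r by (metis less_imp_le not_le power_decreasing order.strict_implies_order not_less)
  have rpos: "0 < r ^ a" for a using r by simp
  have gap_F: "r ^ (i div 2) + r ^ (j div 2) \<le> F j - F i" if less: "F i < F j" for i j
  proof -
    have sum: "r ^ a + r ^ b \<le> C * (r ^ a + r ^ b)" for a b
      using mult_right_mono[of 1 C "r ^ a + r ^ b"] C(1) rpos[of a] rpos[of b] by simp
    consider "even i" "even j" | "even i" "odd j" | "odd i" "even j" | "odd i" "odd j" by blast
    then show ?thesis
    proof cases
      case 1
      then have "C * r ^ (j div 2) < C * r ^ (i div 2)" using less by (simp add: F_def)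
      then have "i div 2 < j div 2" using C(1) by (intro power_less) simp
      then show ?thesis using gap[of "i div 2" "j div 2"] 1 by (simp add: F_def algebra_simps)
    next
      case 2
      then show ?thesis using sum[of "i div 2" "j div 2"] by (simp add: F_def algebra_simps)
    next
      case 3
      then have "C * r ^ (i div 2) < - (C * r ^ (j div 2))" using less by (simp add: F_def)
      moreover have "0 < C * r ^ (i div 2)" "0 < C * r ^ (j div 2)" using C(1) rpos by simp_all
      ultimately show ?thesis by linarith
    next
      case 4
      then have "C * r ^ (i div 2) < C * r ^ (j div 2)" using less by (simp add: F_def)
      then have "j div 2 < i div 2" using C(1) by (intro power_less) simp
      then show ?thesis using gap[of "j div 2" "i div 2"] 4 by (simp add: F_def algebra_simps)
    qed
  qed
  have "inj F"
  proof (rule injI)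
    fix i j assume eq: "F i = F j"
    have "0 < C * r ^ (i div 2)" "0 < C * r ^ (j div 2)" using C(1) rpos by simp_all
    then have parity: "even i = even j" using eq unfolding F_def by (auto split: if_splits)
    then have "r ^ (i div 2) = r ^ (j div 2)" using eq C(1) by (auto simp: F_def split: if_splits)
    then have "i div 2 = j div 2" using r power_inject_exp'[of r] by auto
    then show "i = j" using parity by (metis dvd_mult_div_cancel odd_two_times_div_two_succ)
  qed
  then interpret dominated_family law F F
  proof (rule dominated_family.intro[rotated 2])
    fix i j I assume less: "F i < F j" and I: "I \<in> (increasing_sets :: 'a set set)"
    show "measure (law i) I \<le> measure (law j) I + (F j - F i)"
      using gap_F[OF less] Cauchy[OF _ I, of "i div 2" "j div 2"] Cauchy[OF _ I, of "j div 2" "i div 2"]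
        rpos[of "i div 2"] rpos[of "j div 2"]
      by (cases "i div 2 \<le> j div 2") (simp_all add: law_def abs_le_iff)
  qed (simp_all add: law_def prob sets_\<mu>)
  obtain M :: "(nat \<Rightarrow> 'a) measure" where coupling: "prob_space M"
      "\<forall>n. (\<lambda>\<omega>. \<omega> n) \<in> borel_measurable M" "\<forall>n. distr M borel (\<lambda>\<omega>. \<omega> n) = law n"
      "\<forall>i j. F i < F j \<longrightarrow> measure M {\<omega> \<in> space M. \<not> \<omega> i \<le> \<omega> j} \<le> F j - F i"
    using monotone_coupling[OF closed_order] by (elim exE conjE)
  interpret M: prob_space M by fact
  have coord[measurable]: "(\<lambda>\<omega>. \<omega> n) \<in> borel_measurable M" for n using coupling(2) by simp
  define bad where "bad i j = {\<omega> \<in> space M. \<not> \<omega> i \<le> \<omega> j}" for i j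
  have bad_sets: "bad i j \<in> sets M" for i j
    unfolding bad_def using sets_Collect_le_closed_order[OF closed_order coord coord, of i j]
    by (rule sets.sets_Collect_neg)
  have eventually_ordered: "AE \<omega> in M. \<forall>\<^sub>F n in sequentially. \<omega> (i n) \<le> \<omega> (j n)"
    if less: "\<And>n. F (i n) < F (j n)" and bound: "\<And>n. F (j n) - F (i n) \<le> 2 * C * r ^ n" for i j
  proof -
    have "measure M (bad (i n) (j n)) \<le> 2 * C * r ^ n" for n
      using coupling(4)[rule_format, OF less] bound unfolding bad_def by (rule order_trans)
    then have le: "norm (measure M (bad (i n) (j n))) \<le> 2 * C * r ^ n" for n by simp
    have "summable (\<lambda>n. 2 * C * r ^ n)" using r by (intro summable_mult summable_geometric) simp
    then have summable: "summable (\<lambda>n. measure M (bad (i n) (j n)))"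
      by (rule summable_comparison_test'[where N = 0]) (rule le)
    have "AE \<omega> in M. \<forall>\<^sub>F n in sequentially. \<omega> \<in> space M - bad (i n) (j n)"
      by (rule borel_cantelli_AE1[OF bad_sets _ summable]) (simp add: M.emeasure_eq_measure)
    then show ?thesis
    proof (rule AE_mp, intro AE_I2 impI)
      fix \<omega> assume "\<forall>\<^sub>F n in sequentially. \<omega> \<in> space M - bad (i n) (j n)"
      then show "\<forall>\<^sub>F n in sequentially. \<omega> (i n) \<le> \<omega> (j n)"
        by (rule eventually_mono) (auto simp: bad_def)
    qed
  qed
  have rS: "r ^ Suc n < r ^ n" for n using r rpos[of n] by simp
  have asc: "AE \<omega> in M. \<forall>\<^sub>F n in sequentially. \<omega> (2 * n) \<le> \<omega> (2 * Suc n)"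
  proof (rule eventually_ordered)
    fix n
    show "F (2 * n) < F (2 * Suc n)" using mult_strict_left_mono[OF rS, of C n] C(1) unfolding F_even by simp
    show "F (2 * Suc n) - F (2 * n) \<le> 2 * C * r ^ n"
      using C(1) rpos[of n] rpos[of "Suc n"] mult_pos_pos[of C "r ^ Suc n"] mult_pos_pos[of C "r ^ n"]
      unfolding F_even by linarith
  qed
  have cross: "AE \<omega> in M. \<forall>\<^sub>F n in sequentially. \<omega> (2 * n) \<le> \<omega> (Suc (2 * n))"
  proof (rule eventually_ordered)
    fix n
    show "F (2 * n) < F (Suc (2 * n))" "F (Suc (2 * n)) - F (2 * n) \<le> 2 * C * r ^ n"
      using C(1) rpos[of n] mult_pos_pos[of C "r ^ n"] unfolding F_even F_odd by linarith+
  qed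
  have desc: "AE \<omega> in M. \<forall>\<^sub>F n in sequentially. \<omega> (Suc (2 * Suc n)) \<le> \<omega> (Suc (2 * n))"
  proof (rule eventually_ordered)
    fix n
    show "F (Suc (2 * Suc n)) < F (Suc (2 * n))"
      using mult_strict_left_mono[OF rS, of C n] C(1) unfolding F_odd by simp
    show "F (Suc (2 * n)) - F (Suc (2 * Suc n)) \<le> 2 * C * r ^ n"
      using C(1) rpos[of n] rpos[of "Suc n"] mult_pos_pos[of C "r ^ Suc n"] mult_pos_pos[of C "r ^ n"]
      unfolding F_odd by linarith
  qed
  define limit where "limit \<omega> y \<longleftrightarrow> (\<lambda>n. \<omega> (2 * n)) \<longlonglongrightarrow> y \<and>
      (\<forall>\<^sub>F n in sequentially. \<omega> (2 * n) \<le> y \<and> y \<le> \<omega> (Suc (2 * n)))" for \<omega> :: "nat \<Rightarrow> 'a" and y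
  have "AE \<omega> in M. \<exists>y. limit \<omega> y"
    using asc cross desc
  proof eventually_elim
    case (elim \<omega>)
    show ?case
      unfolding limit_def
    proof (rule squeezed_sequence_converges[OF closed_order])
      show "\<And>(s::nat \<Rightarrow> 'a) y. incseq s \<Longrightarrow> (\<And>n. s n \<le> y) \<Longrightarrow> convergent s" by (rule BMC)
      show "\<forall>\<^sub>F n in sequentially. \<omega> (2 * n) \<le> \<omega> (2 * Suc n) \<and>
          \<omega> (2 * n) \<le> \<omega> (Suc (2 * n)) \<and> \<omega> (Suc (2 * Suc n)) \<le> \<omega> (Suc (2 * n))"
        by (rule eventually_conj[OF elim(1) eventually_conj[OF elim(2) elim(3)]])
    qed
  qed
  then obtain E where E: "E \<in> null_sets M" and lim: "\<And>\<omega>. \<omega> \<in> space M - E \<Longrightarrow> \<exists>y. limit \<omega> y"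
    by (rule AE_E3) blast
  have [measurable]: "E \<in> sets M" using E by (rule null_setsD2)
  define Y where "Y \<omega> = (SOME y. limit \<omega> y)" for \<omega>
  have Y: "limit \<omega> (Y \<omega>)" if "\<omega> \<in> space M" "\<omega> \<notin> E" for \<omega>
    unfolding Y_def using lim that by (intro someI_ex[of "limit \<omega>"]) simp
  \<comment> \<open>Off the null set \<open>E\<close> this is the limit; the constant value on \<open>E\<close> keeps it a pointwise limit of
    measurable functions.\<close>
  define Y' where "Y' \<omega> = (if \<omega> \<in> E then undefined else Y \<omega>)" for \<omega>
  have Y'[measurable]: "Y' \<in> borel_measurable M"
  proof (rule borel_measurable_LIMSEQ_metric)
    show "(\<lambda>\<omega>. if \<omega> \<in> E then undefined else \<omega> (2 * n)) \<in> borel_measurable M" for n by measurable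
    show "(\<lambda>n. if \<omega> \<in> E then undefined else \<omega> (2 * n)) \<longlonglongrightarrow> Y' \<omega>" if "\<omega> \<in> space M" for \<omega>
      using Y[of \<omega>] that by (simp add: Y'_def limit_def)
  qed
  have squeeze: "AE \<omega> in M. \<forall>\<^sub>F n in sequentially. \<omega> (2 * n) \<le> Y' \<omega> \<and> Y' \<omega> \<le> \<omega> (Suc (2 * n))"
    using AE_not_in[OF E]
  proof (rule AE_mp, intro AE_I2 impI)
    fix \<omega> assume "\<omega> \<in> space M" "\<omega> \<notin> E"
    then show "\<forall>\<^sub>F n in sequentially. \<omega> (2 * n) \<le> Y' \<omega> \<and> Y' \<omega> \<le> \<omega> (Suc (2 * n))"
      using Y[of \<omega>] by (simp add: Y'_def limit_def)
  qed
  have "(\<lambda>n. \<integral>x. g x \<partial>\<mu> n) \<longlonglongrightarrow> (\<integral>x. g x \<partial>distr M borel Y')"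
    if g[measurable]: "g \<in> borel_measurable borel" and range: "range g \<subseteq> {0..1::real}" and "mono g" for g
  proof -
    have g01: "0 \<le> g x" "g x \<le> 1" for x using range by (auto simp: image_subset_iff)
    have int: "integrable M (\<lambda>\<omega>. g (V \<omega>))" if [measurable]: "V \<in> borel_measurable M" for V
      using g01 by (intro M.integrable_const_bound[of _ 1]) auto
    have law_g: "(\<integral>x. g x \<partial>\<mu> n) = (\<integral>\<omega>. g (\<omega> k) \<partial>M)" if "k div 2 = n" for k n
      using coupling(3)[rule_format, of k, symmetric] that
      by (simp add: law_def integral_distr)
    have lim_g: "(\<integral>x. g x \<partial>distr M borel Y') = (\<integral>\<omega>. g (Y' \<omega>) \<partial>M)"
      by (rule integral_distr) simp_all
    \<comment> \<open>the amounts by which the sandwich fails; for almost every \<open>\<omega>\<close> they vanish eventually\<close>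
    define U where "U n \<omega> = max 0 (g (\<omega> (2 * n)) - g (Y' \<omega>))" for n \<omega>
    define V where "V n \<omega> = max 0 (g (Y' \<omega>) - g (\<omega> (Suc (2 * n))))" for n \<omega>
    have bounds: "\<bar>U n \<omega>\<bar> \<le> 1" "\<bar>V n \<omega>\<bar> \<le> 1" for n \<omega>
      using g01[of "\<omega> (2 * n)"] g01[of "Y' \<omega>"] g01[of "\<omega> (Suc (2 * n))"] by (auto simp: U_def V_def)
    have [measurable]: "U n \<in> borel_measurable M" "V n \<in> borel_measurable M" for n
      unfolding U_def V_def by measurable
    have "AE \<omega> in M. (\<lambda>n. U n \<omega>) \<longlonglongrightarrow> 0 \<and> (\<lambda>n. V n \<omega>) \<longlonglongrightarrow> 0"
      using squeeze
    proof eventually_elim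
      case (elim \<omega>)
      then have "\<forall>\<^sub>F n in sequentially. U n \<omega> = 0 \<and> V n \<omega> = 0"
      proof (rule eventually_mono, elim conjE)
        fix n assume "\<omega> (2 * n) \<le> Y' \<omega>" "Y' \<omega> \<le> \<omega> (Suc (2 * n))"
        then have "g (\<omega> (2 * n)) \<le> g (Y' \<omega>)" "g (Y' \<omega>) \<le> g (\<omega> (Suc (2 * n)))"
          using \<open>mono g\<close> by (simp_all add: monoD)
        then show "U n \<omega> = 0 \<and> V n \<omega> = 0" by (simp add: U_def V_def)
      qed
      then show ?case by (auto intro: tendsto_eventually elim: eventually_mono)
    qed
    then have zero: "AE \<omega> in M. (\<lambda>n. U n \<omega>) \<longlonglongrightarrow> 0" "AE \<omega> in M. (\<lambda>n. V n \<omega>) \<longlonglongrightarrow> 0" by auto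
    have "(\<lambda>n. \<integral>\<omega>. U n \<omega> \<partial>M) \<longlonglongrightarrow> (\<integral>\<omega>. 0 \<partial>M)"
      using zero(1) bounds by (intro integral_dominated_convergence[where w = "\<lambda>_. 1"]) auto
    moreover have "(\<lambda>n. \<integral>\<omega>. V n \<omega> \<partial>M) \<longlonglongrightarrow> (\<integral>\<omega>. 0 \<partial>M)"
      using zero(2) bounds by (intro integral_dominated_convergence[where w = "\<lambda>_. 1"]) auto
    ultimately have UV: "(\<lambda>n. \<integral>\<omega>. U n \<omega> \<partial>M) \<longlonglongrightarrow> 0" "(\<lambda>n. \<integral>\<omega>. V n \<omega> \<partial>M) \<longlonglongrightarrow> 0"
      by simp_all
    have intUV: "integrable M (U n)" "integrable M (V n)" for n
      using bounds by (auto intro!: M.integrable_const_bound[of _ 1])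
    have upper: "(\<integral>x. g x \<partial>\<mu> n) \<le> (\<integral>\<omega>. g (Y' \<omega>) \<partial>M) + (\<integral>\<omega>. U n \<omega> \<partial>M)" for n
    proof -
      have "(\<integral>x. g x \<partial>\<mu> n) = (\<integral>\<omega>. g (\<omega> (2 * n)) \<partial>M)" by (rule law_g) simp
      also have "\<dots> \<le> (\<integral>\<omega>. g (Y' \<omega>) + U n \<omega> \<partial>M)"
        by (intro integral_mono int Bochner_Integration.integrable_add intUV) (auto simp: U_def)
      also have "\<dots> = (\<integral>\<omega>. g (Y' \<omega>) \<partial>M) + (\<integral>\<omega>. U n \<omega> \<partial>M)"
        by (intro Bochner_Integration.integral_add int intUV) simp
      finally show ?thesis .
    qed
    have lower: "(\<integral>\<omega>. g (Y' \<omega>) \<partial>M) - (\<integral>\<omega>. V n \<omega> \<partial>M) \<le> (\<integral>x. g x \<partial>\<mu> n)" for n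
    proof -
      have "(\<integral>\<omega>. g (Y' \<omega>) \<partial>M) - (\<integral>\<omega>. V n \<omega> \<partial>M) = (\<integral>\<omega>. g (Y' \<omega>) - V n \<omega> \<partial>M)"
        by (intro Bochner_Integration.integral_diff[symmetric] int intUV) simp
      also have "\<dots> \<le> (\<integral>\<omega>. g (\<omega> (Suc (2 * n))) \<partial>M)"
        by (intro integral_mono int Bochner_Integration.integrable_diff intUV) (auto simp: V_def)
      also have "\<dots> = (\<integral>x. g x \<partial>\<mu> n)" by (rule law_g[symmetric]) simp
      finally show ?thesis .
    qed
    show ?thesis
      unfolding lim_g
    proof (rule tendsto_sandwich)
      show "(\<lambda>n. (\<integral>\<omega>. g (Y' \<omega>) \<partial>M) - (\<integral>\<omega>. V n \<omega> \<partial>M)) \<longlonglongrightarrow> (\<integral>\<omega>. g (Y' \<omega>) \<partial>M)"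
        using tendsto_diff[OF tendsto_const UV(2), of "\<integral>\<omega>. g (Y' \<omega>) \<partial>M"] by simp
      show "(\<lambda>n. (\<integral>\<omega>. g (Y' \<omega>) \<partial>M) + (\<integral>\<omega>. U n \<omega> \<partial>M)) \<longlonglongrightarrow> (\<integral>\<omega>. g (Y' \<omega>) \<partial>M)"
        using tendsto_add[OF tendsto_const UV(1), of "\<integral>\<omega>. g (Y' \<omega>) \<partial>M"] by simp
    qed (simp_all add: upper lower)
  qed
  moreover have "prob_space (distr M borel Y')" by (rule M.prob_space_distr) (rule Y')
  ultimately show ?thesis by (intro exI[of _ "distr M borel Y'"]) simp
qed

section \<open>Iterated Markov kernels\<close>

lemma nstep_kernel:
  assumes "markov_kernel P"
  shows "nstep P n \<in> borel \<rightarrow>\<^sub>M prob_algebra borel"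
proof (induction n)
  case (Suc n)
  show ?case
    using measurable_bind_prob_space[OF assms[unfolded markov_kernel_def] Suc] by simp
qed simp

context
  fixes P :: "'a::topological_space \<Rightarrow> 'a measure"
  assumes kernel: "markov_kernel P"
begin

lemma nstep_subprob_kernel: "nstep P n \<in> borel \<rightarrow>\<^sub>M subprob_algebra borel"
  by (rule measurable_prob_algebraD) (rule nstep_kernel[OF kernel])

lemma P_subprob_kernel: "P \<in> borel \<rightarrow>\<^sub>M subprob_algebra borel"
  by (rule measurable_prob_algebraD) (rule kernel[unfolded markov_kernel_def])

lemma prob_space_nstep: "prob_space (nstep P n x)" and sets_nstep: "sets (nstep P n x) = sets borel"
  using measurable_space[OF nstep_kernel[OF kernel], of x n] by (auto simp: space_prob_algebra)

lemma nstep_add: "nstep P (m + n) x = nstep P m x \<bind> nstep P n"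
proof (induction m arbitrary: x)
  case 0
  then show ?case by (simp add: bind_return[OF nstep_subprob_kernel])
next
  case (Suc m)
  have sets_P: "sets (P x) = sets borel"
    using kernel by (auto simp: markov_kernel_iff)
  have "nstep P m \<in> P x \<rightarrow>\<^sub>M subprob_algebra borel"
    using nstep_subprob_kernel by (simp add: measurable_cong_sets[OF sets_P refl])
  then have "(P x \<bind> nstep P m) \<bind> nstep P n = P x \<bind> (\<lambda>y. nstep P m y \<bind> nstep P n)"
    by (rule bind_assoc) (rule nstep_subprob_kernel)
  moreover have "nstep P (m + n) = (\<lambda>y. nstep P m y \<bind> nstep P n)" using Suc.IH by (rule ext)
  ultimately show ?case by simp
qed

lemma nstep_1: "nstep P 1 = P"
proof
  fix x
  have "sets (P x) = sets borel" using kernel by (auto simp: markov_kernel_iff)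
  then have "P x \<bind> return borel = P x"
    by (metis bind_return' return_sets_cong)
  then show "nstep P 1 x = P x" by simp
qed

lemma integral_nstep_add:
  fixes g :: "'a \<Rightarrow> real"
  assumes "g \<in> borel_measurable borel" and bound: "\<And>x. \<bar>g x\<bar> \<le> B"
  shows "(\<integral>y. g y \<partial>nstep P (m + n) x) = (\<integral>z. (\<integral>y. g y \<partial>nstep P n z) \<partial>nstep P m x)"
  unfolding nstep_add
proof (rule integral_bind[where K = borel and B = B and B' = 1])
  show "nstep P n \<in> nstep P m x \<rightarrow>\<^sub>M subprob_algebra borel"
    using nstep_subprob_kernel by (simp add: measurable_cong_sets[OF sets_nstep refl])
  show "finite_measure (nstep P m x)"
    using prob_space_nstep by (simp add: prob_space.finite_measure)
  show "AE z in nstep P m x. emeasure (nstep P n z) (space (nstep P n z)) \<le> ennreal 1"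
    using prob_space.emeasure_space_1[OF prob_space_nstep] by simp
qed (use assms in auto)

lemma integral_nstep_measurable:
  fixes g :: "'a \<Rightarrow> real"
  assumes "g \<in> borel_measurable borel"
  shows "(\<lambda>x. \<integral>y. g y \<partial>nstep P n x) \<in> borel_measurable borel"
  using measurable_compose[OF nstep_subprob_kernel integral_measurable_subprob_algebra[OF assms]] .

lemma integral_nstep_bounds:
  fixes g :: "'a \<Rightarrow> real"
  assumes "g \<in> borel_measurable borel" and "\<And>x. a \<le> g x" "\<And>x. g x \<le> b"
  shows "a \<le> (\<integral>y. g y \<partial>nstep P n x)" "(\<integral>y. g y \<partial>nstep P n x) \<le> b"
proof -
  interpret prob_space "nstep P n x" by (rule prob_space_nstep)
  have "g \<in> borel_measurable (nstep P n x)"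
    using assms(1) by (simp add: measurable_cong_sets[OF sets_nstep refl])
  moreover have "norm (g y) \<le> max \<bar>a\<bar> \<bar>b\<bar>" for y using assms(2,3)[of y] by auto
  ultimately have "integrable (nstep P n x) g"
    by (intro integrable_const_bound[of _ "max \<bar>a\<bar> \<bar>b\<bar>"] AE_I2)
  then show "a \<le> (\<integral>y. g y \<partial>nstep P n x)" "(\<integral>y. g y \<partial>nstep P n x) \<le> b"
    using assms(2,3) by (auto intro!: integral_ge_const integral_le_const)
qed

lemma stationary_nstep:
  assumes "stationary_distribution P \<pi>"
  shows "\<pi> \<bind> nstep P n = \<pi>"
proof (induction n)
  case 0
  then show ?case
    using assms unfolding stationary_distribution_def by simp (metis bind_return' return_sets_cong)
next
  case (Suc n)
  have "P \<in> \<pi> \<rightarrow>\<^sub>M subprob_algebra borel"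
    using P_subprob_kernel assms by (simp add: stationary_distribution_def cong: measurable_cong_sets)
  then have "(\<pi> \<bind> P) \<bind> nstep P n = \<pi> \<bind> (\<lambda>x. P x \<bind> nstep P n)"
    by (rule bind_assoc) (rule nstep_subprob_kernel)
  then show ?case using Suc assms by (simp add: stationary_distribution_def)
qed

text \<open>
  The chain is only described by conditional probabilities; taking expectations of these turns the
  law of \<open>X n\<close> into that of \<open>X (Suc n)\<close> by one application of the kernel.
\<close>

lemma markov_chain_law:
  assumes chain: "markov_chain P x M X"
  shows "distr M borel (X n) = nstep P n x"
proof (induction n)
  have [measurable]: "X n \<in> borel_measurable M" for n using chain by (simp add: markov_chain_def)
  interpret prob_space M using chain by (simp add: markov_chain_def)
  case 0
  have "distr M borel (X 0) = distr M borel (\<lambda>_. x)"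
    using chain by (intro distr_cong_AE) (auto simp: markov_chain_def)
  then show ?case by (simp add: distr_const)
next
  have X[measurable]: "X n \<in> borel_measurable M" for n using chain by (simp add: markov_chain_def)
  interpret prob_space M using chain by (simp add: markov_chain_def)
  case (Suc n)
  have step: "nstep P (Suc n) x = nstep P n x \<bind> P"
    using nstep_add[of n 1 x] by (simp only: nstep_1 Suc_eq_plus1)
  interpret n: prob_space "nstep P n x" by (rule prob_space_nstep)
  let ?F = "natural_filtration M X n"
  have "finite_measure_subalgebra M ?F"
  proof (unfold_locales)
    show "subalgebra M ?F"
      unfolding subalgebra_def natural_filtration_def
      by (auto intro!: sets.sigma_sets_subset simp: space_measure_of_conv sets_measure_of_conv)
  qed
  then interpret sigma_finite_subalgebra M ?F by (rule finite_measure_subalgebra_is_sigma_finite)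
  show ?case
  proof (rule measure_eqI)
    show "sets (distr M borel (X (Suc n))) = sets (nstep P (Suc n) x)"
      by (simp only: sets_nstep sets_distr)
    fix A assume "A \<in> sets (distr M borel (X (Suc n)))"
    then have A[measurable]: "A \<in> sets borel" by simp
    have meas_P: "(\<lambda>y. measure (P y) A) \<in> borel_measurable borel"
      using kernel A by (simp add: markov_kernel_iff)
    have int: "integrable M (\<lambda>\<omega>. indicat_real A (X (Suc n) \<omega>))"
      by (intro integrable_const_bound[of _ 1]) (auto simp: indicator_def)
    have "measure (distr M borel (X (Suc n))) A = (\<integral>y. indicat_real A y \<partial>distr M borel (X (Suc n)))"
      by simp
    also have "\<dots> = (\<integral>\<omega>. indicat_real A (X (Suc n) \<omega>) \<partial>M)"
      by (rule integral_distr) simp_all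
    also have "\<dots> = (\<integral>\<omega>. real_cond_exp M ?F (\<lambda>\<omega>'. indicat_real A (X (Suc n) \<omega>')) \<omega> \<partial>M)"
      using real_cond_exp_intg(2)[of "\<lambda>_. 1" "\<lambda>\<omega>. indicat_real A (X (Suc n) \<omega>)"] int by simp
    also have "\<dots> = (\<integral>\<omega>. measure (P (X n \<omega>)) A \<partial>M)"
    proof (rule integral_cong_AE)
      show "AE \<omega> in M. real_cond_exp M ?F (\<lambda>\<omega>'. indicat_real A (X (Suc n) \<omega>')) \<omega> = measure (P (X n \<omega>)) A"
        using chain A by (simp add: markov_chain_def)
      show "(\<lambda>\<omega>. measure (P (X n \<omega>)) A) \<in> borel_measurable M"
        by (rule measurable_compose[OF X meas_P])
    qed simp
    also have "\<dots> = (\<integral>y. measure (P y) A \<partial>distr M borel (X n))"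
      by (rule integral_distr[symmetric]) (rule X, rule meas_P)
    also have "\<dots> = (\<integral>y. measure (P y) A \<partial>nstep P n x)" by (simp only: Suc.IH)
    also have "\<dots> = measure (nstep P (Suc n) x) A"
      unfolding step using P_subprob_kernel
      by (intro n.measure_bind[OF _ A, symmetric]) (simp add: measurable_cong_sets[OF sets_nstep refl])
    finally have "measure (distr M borel (X (Suc n))) A = measure (nstep P (Suc n) x) A" .
    moreover interpret d: prob_space "distr M borel (X (Suc n))" by (rule prob_space_distr) simp
    interpret s: prob_space "nstep P (Suc n) x" by (rule prob_space_nstep)
    show "emeasure (distr M borel (X (Suc n))) A = emeasure (nstep P (Suc n) x) A"
      by (simp only: d.emeasure_eq_measure s.emeasure_eq_measure calculation)
  qed
qed

end

section \<open>Contraction and the stationary distribution\<close>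

lemma mono_indicator_increasing: "I \<in> increasing_sets \<Longrightarrow> mono (indicat_real I)"
  unfolding increasing_sets_def by (auto simp: mono_def indicator_def)

lemma
  fixes P :: "'a::{polish_space, order} \<Rightarrow> 'a measure" and g :: "'a \<Rightarrow> real"
  assumes kernel: "markov_kernel P" and monotone: "stochastically_monotone P"
    and g: "g \<in> borel_measurable borel" "range g \<subseteq> {0..1}" "mono g"
  shows mono_integral_nstep: "mono (\<lambda>x. \<integral>y. g y \<partial>nstep P n x)"
    and range_integral_nstep: "range (\<lambda>x. \<integral>y. g y \<partial>nstep P n x) \<subseteq> {0..1}"
proof -
  have g01: "0 \<le> g x" "g x \<le> 1" for x using g(2) by (auto simp: image_subset_iff)
  then have g_le: "\<bar>g x\<bar> \<le> 1" for x by simp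
  have range: "range (\<lambda>x. \<integral>y. g y \<partial>nstep P n x) \<subseteq> {0..1}" for n
    using integral_nstep_bounds[OF kernel g(1) g01] by auto
  then show "range (\<lambda>x. \<integral>y. g y \<partial>nstep P n x) \<subseteq> {0..1}" .
  show "mono (\<lambda>x. \<integral>y. g y \<partial>nstep P n x)"
  proof (induction n)
    case 0
    then show ?case using g by (simp add: integral_return)
  next
    case (Suc n)
    have "(\<lambda>x. \<integral>y. g y \<partial>nstep P (Suc n) x) = (\<lambda>x. \<integral>z. (\<integral>y. g y \<partial>nstep P n z) \<partial>P x)"
      using integral_nstep_add[OF kernel g(1) g_le, of 1 n]
      unfolding nstep_1[OF kernel] plus_1_eq_Suc by (rule ext)
    then show ?case
      using monotone integral_nstep_measurable[OF kernel g(1)] range Suc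
      unfolding stochastically_monotone_def by simp
  qed
qed

text \<open>
  The interval of values of \<open>h\<close>, the iterate obtained so far, is pulled towards the single number
  \<open>h c\<close> from both sides by one more block of \<open>N\<close> steps. The remaining \<open>m = n mod N\<close> steps
  only have to keep the function increasing and within \<open>[0, 1]\<close>.
\<close>

lemma oscillation_contraction:
  fixes P :: "'a::{polish_space, order} \<Rightarrow> 'a measure" and g :: "'a \<Rightarrow> real"
  assumes closed_order: "closed {(x::'a, y). x \<le> y}"
    and kernel: "markov_kernel P" and monotone: "stochastically_monotone P"
    and lower: "\<And>z. measure (nstep P N z) {x. x \<le> c} \<ge> \<epsilon>"
    and upper: "\<And>z. measure (nstep P N z) {x. c \<le> x} \<ge> \<epsilon>"
    and g: "g \<in> borel_measurable borel" "range g \<subseteq> {0..1}" "mono g"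
  shows "\<bar>(\<integral>u. g u \<partial>nstep P n x) - (\<integral>u. g u \<partial>nstep P n y)\<bar> \<le> (1 - \<epsilon>) ^ (n div N)"
proof -
  have "\<exists>a b. b - a = (1 - \<epsilon>) ^ k \<and>
      (\<forall>x. a \<le> (\<integral>u. g u \<partial>nstep P (k * N + m) x) \<and> (\<integral>u. g u \<partial>nstep P (k * N + m) x) \<le> b)" for k m
  proof (induction k)
    case 0
    show ?case
      using range_integral_nstep[OF kernel monotone g, of m]
      by (intro exI[of _ 0] exI[of _ 1]) (auto simp: image_subset_iff)
  next
    case (Suc k)
    define h where "h x = (\<integral>u. g u \<partial>nstep P (k * N + m) x)" for x
    from Suc obtain a b where ab: "b - a = (1 - \<epsilon>) ^ k" "\<And>x. a \<le> h x" "\<And>x. h x \<le> b"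
      unfolding h_def by blast
    have h: "h \<in> borel_measurable borel" "mono h"
      unfolding h_def using integral_nstep_measurable[OF kernel g(1)]
        mono_integral_nstep[OF kernel monotone g] by simp_all
    have step: "(\<integral>u. g u \<partial>nstep P (Suc k * N + m) x) = (\<integral>z. h z \<partial>nstep P N x)" for x
      unfolding h_def using integral_nstep_add[OF kernel g(1), of 1 N "k * N + m" x] g(2)
      by (simp add: image_subset_iff add.assoc)
    have "\<epsilon> * h c + (1 - \<epsilon>) * a \<le> (\<integral>z. h z \<partial>nstep P N x) \<and>
        (\<integral>z. h z \<partial>nstep P N x) \<le> \<epsilon> * h c + (1 - \<epsilon>) * b" for x
    proof -
      interpret prob_space "nstep P N x" by (rule prob_space_nstep[OF kernel])
      have "{x \<in> space borel. x \<le> c} \<in> sets borel" "{x \<in> space borel. c \<le> x} \<in> sets borel"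
        by (rule sets_Collect_le_closed_order[OF closed_order]; measurable)+
      then have events: "{x. x \<le> c} \<in> events" "{x. c \<le> x} \<in> events"
        by (simp_all only: sets_nstep[OF kernel] space_borel UNIV_I simp_thms)
      have space: "space (nstep P N x) = UNIV"
        using sets_eq_imp_space_eq[OF sets_nstep[OF kernel]] by simp
      have "h \<in> borel_measurable (nstep P N x)"
        unfolding measurable_cong_sets[OF sets_nstep[OF kernel] refl] by (rule h(1))
      moreover have "norm (h y) \<le> max \<bar>a\<bar> \<bar>b\<bar>" for y using ab(2,3)[of y] by auto
      ultimately have int_h: "integrable (nstep P N x) h"
        by (intro integrable_const_bound[of _ "max \<bar>a\<bar> \<bar>b\<bar>"] AE_I2)
      have int: "integrable (nstep P N x) (indicat_real {x. x \<le> c})"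
          "integrable (nstep P N x) (indicat_real {x. c \<le> x})"
        using events by (intro integrable_real_indicator, simp_all add: emeasure_eq_measure)+
      have "(\<integral>z. h z \<partial>nstep P N x) \<le> (\<integral>z. b - (b - h c) * indicat_real {x. x \<le> c} z \<partial>nstep P N x)"
      proof (rule integral_mono[OF int_h])
        show "integrable (nstep P N x) (\<lambda>z. b - (b - h c) * indicat_real {x. x \<le> c} z)"
          by (intro Bochner_Integration.integrable_diff integrable_mult_right integrable_const int(1))
        show "h z \<le> b - (b - h c) * indicat_real {x. x \<le> c} z" for z
          using ab(3)[of z] monoD[OF h(2), of z c] by (simp add: indicator_def)
      qed
      also have "\<dots> = b - (b - h c) * prob {x. x \<le> c}"
        using int by (simp add: space prob_space[unfolded space])
      also have "\<dots> \<le> b - (b - h c) * \<epsilon>"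
        using lower[of x] ab(3)[of c] by (intro diff_left_mono mult_left_mono) auto
      finally have up: "(\<integral>z. h z \<partial>nstep P N x) \<le> \<epsilon> * h c + (1 - \<epsilon>) * b"
        by (simp add: algebra_simps)
      have "a + (h c - a) * \<epsilon> \<le> a + (h c - a) * prob {x. c \<le> x}"
        using upper[of x] ab(2)[of c] by (intro add_left_mono mult_left_mono) auto
      also have "\<dots> = (\<integral>z. a + (h c - a) * indicat_real {x. c \<le> x} z \<partial>nstep P N x)"
        using int by (simp add: space prob_space[unfolded space])
      also have "\<dots> \<le> (\<integral>z. h z \<partial>nstep P N x)"
      proof (rule integral_mono[OF _ int_h])
        show "integrable (nstep P N x) (\<lambda>z. a + (h c - a) * indicat_real {x. c \<le> x} z)"
          by (intro Bochner_Integration.integrable_add integrable_mult_right integrable_const int(2))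
        show "a + (h c - a) * indicat_real {x. c \<le> x} z \<le> h z" for z
          using ab(2)[of z] monoD[OF h(2), of c z] by (simp add: indicator_def)
      qed
      finally show ?thesis using up by (simp add: algebra_simps)
    qed
    moreover have "(\<epsilon> * h c + (1 - \<epsilon>) * b) - (\<epsilon> * h c + (1 - \<epsilon>) * a) = (1 - \<epsilon>) ^ Suc k"
      using ab(1) by (simp add: algebra_simps)
    ultimately show ?case unfolding step by blast
  qed
  from this[of "n div N" "n mod N"] obtain a b where "b - a = (1 - \<epsilon>) ^ (n div N)"
      "\<And>x. a \<le> (\<integral>u. g u \<partial>nstep P n x) \<and> (\<integral>u. g u \<partial>nstep P n x) \<le> b"
    by auto
  from this(1) this(2)[of x] this(2)[of y] show ?thesis by linarith
qed

lemma floor_power_le_geometric: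
  fixes r :: real
  assumes "0 < r" "r < 1" and N: "1 \<le> N"
  shows "r ^ (n div N) \<le> (1 / r) * root N r ^ n"
proof -
  have "n \<le> Suc (n div N) * N"
    using dividend_less_div_times[of N n] N by simp
  then have "root N r ^ (Suc (n div N) * N) \<le> root N r ^ n"
    using assms by (intro power_decreasing) simp_all
  also have "root N r ^ (Suc (n div N) * N) = r ^ Suc (n div N)"
    using assms by (metis less_imp_le mult.commute not_one_le_zero power_mult real_root_pow_pos2 zero_less_iff_neq_zero)
  finally show ?thesis using assms(1) by (simp add: field_simps)
qed

theorem corollary6p2:
  fixes P :: "'a::{polish_space, order} \<Rightarrow> 'a measure"
    and c :: 'a and \<epsilon> :: real and N :: nat
  assumes closed_order: "closed {(x::'a, y). x \<le> y}"
    and BMC: "\<And>(s::nat \<Rightarrow> 'a) y. incseq s \<Longrightarrow> (\<And>n. s n \<le> y) \<Longrightarrow> convergent s"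
    and kernel: "markov_kernel P"
    and monotone: "stochastically_monotone P"
    and eps: "\<epsilon> > 0"
    and N: "N \<ge> 1"
    and lower: "\<And>z. measure (nstep P N z) {x. x \<le> c} \<ge> \<epsilon>"
    and upper: "\<And>z. measure (nstep P N z) {x. c \<le> x} \<ge> \<epsilon>"
  shows "\<exists>\<pi>. stationary_distribution P \<pi> \<and>
    (\<forall>\<pi>'. stationary_distribution P \<pi>' \<longrightarrow> \<pi>' = \<pi>) \<and>
    (\<forall>x. \<forall>n\<ge>1. (SUP I\<in>increasing_sets. \<bar>measure (nstep P n x) I - measure \<pi> I\<bar>)
        \<le> (1 - \<epsilon>) ^ (n div N)) \<and>
    (\<forall>x (M::'w measure) X. markov_chain P x M X \<longrightarrow>
      (\<forall>n\<ge>1. (SUP I\<in>increasing_sets. \<bar>\<P>(\<omega> in M. X n \<omega> \<in> I) - measure \<pi> I\<bar>)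
        \<le> (1 - \<epsilon>) ^ (n div N))) \<and>
    (\<exists>C \<rho>. 0 \<le> \<rho> \<and> \<rho> < 1 \<and>
      (\<forall>x. \<forall>n\<ge>1. (SUP I\<in>increasing_sets. \<bar>measure (nstep P n x) I - measure \<pi> I\<bar>)
        \<le> C * \<rho> ^ n))"
proof -
  have eps1: "\<epsilon> \<le> 1"
    using lower[of c] prob_space.prob_le_1[OF prob_space_nstep[OF kernel]] by (rule order_trans)
  \<comment> \<open>For \<open>\<epsilon> = 1\<close> the bound \<open>(1 - \<epsilon>) ^ (n div N)\<close> is still \<open>1\<close> before step \<open>N\<close>, so a geometric
    bound valid from \<open>n = 1\<close> on needs a positive rate.\<close>
  define r where "r = max (1 - \<epsilon>) (1 / 2)"
  have r: "0 < r" "r < 1" "1 - \<epsilon> \<le> r" using eps by (auto simp: r_def)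
  have power_r: "(1 - \<epsilon>) ^ k \<le> r ^ k" for k using eps1 r by (intro power_mono) auto
  \<comment> \<open>The first \<open>m\<close> steps only average the later ones over starting points.\<close>
  have merge: "\<bar>(\<integral>u. g u \<partial>nstep P (m + n) x) - (\<integral>u. g u \<partial>nstep P n y)\<bar> \<le> (1 - \<epsilon>) ^ (n div N)"
    if g: "g \<in> borel_measurable borel" "range g \<subseteq> {0..1::real}" "mono g" for g m n x y
  proof -
    have "(\<integral>u. g u \<partial>nstep P n y) - (1 - \<epsilon>) ^ (n div N) \<le> (\<integral>u. g u \<partial>nstep P n z)"
        "(\<integral>u. g u \<partial>nstep P n z) \<le> (\<integral>u. g u \<partial>nstep P n y) + (1 - \<epsilon>) ^ (n div N)" for z
      using oscillation_contraction[OF closed_order kernel monotone lower upper g, of n z y]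
      by linarith+
    note bounds = integral_nstep_bounds[OF kernel integral_nstep_measurable[OF kernel g(1)] this]
    have "(\<integral>u. g u \<partial>nstep P (m + n) x) = (\<integral>z. (\<integral>u. g u \<partial>nstep P n z) \<partial>nstep P m x)"
      using g(2) by (intro integral_nstep_add[OF kernel g(1), of 1]) (auto simp: image_subset_iff)
    then show ?thesis using bounds[of m x] by (simp add: abs_le_iff)
  qed
  have indicator: "indicat_real I \<in> borel_measurable borel" "range (indicat_real I) \<subseteq> {0..1}"
      "mono (indicat_real I)" if "I \<in> increasing_sets" for I :: "'a set"
    using that increasing_sets_borel[OF that] mono_indicator_increasing[OF that]
    by (auto simp: indicator_def)
  have integral_indicator: "(\<integral>u. indicat_real I u \<partial>\<mu>) = measure \<mu> I"
    if "sets \<mu> = sets borel" for \<mu> and I :: "'a set"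
    using sets_eq_imp_space_eq[OF that] by simp
  define \<mu> where "\<mu> n = nstep P (n * N) c" for n
  have "\<exists>\<pi>. prob_space \<pi> \<and> sets \<pi> = sets borel \<and>
    (\<forall>g. g \<in> borel_measurable borel \<longrightarrow> range g \<subseteq> {0..1::real} \<longrightarrow> mono g \<longrightarrow>
      (\<lambda>n. \<integral>x. g x \<partial>\<mu> n) \<longlonglongrightarrow> (\<integral>x. g x \<partial>\<pi>))"
  proof (rule increasing_Cauchy_limit_exists[OF closed_order _ _ _ r(1,2)])
    show "\<And>(s::nat \<Rightarrow> 'a) y. incseq s \<Longrightarrow> (\<And>n. s n \<le> y) \<Longrightarrow> convergent s" by (rule BMC)
    show "prob_space (\<mu> n)" "sets (\<mu> n) = sets borel" for n
      by (simp_all only: \<mu>_def prob_space_nstep[OF kernel] sets_nstep[OF kernel])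
    show "\<bar>measure (\<mu> m) I - measure (\<mu> n) I\<bar> \<le> r ^ m" if "m \<le> n" and I: "I \<in> increasing_sets" for m n I
    proof -
      have "n * N = (n - m) * N + m * N" using \<open>m \<le> n\<close> by (metis add.commute add_mult_distrib le_add_diff_inverse)
      then have "\<bar>measure (\<mu> n) I - measure (\<mu> m) I\<bar> \<le> (1 - \<epsilon>) ^ m"
        using merge[OF indicator[OF I], of "(n - m) * N" "m * N" c c] N
        unfolding \<mu>_def by (simp only: integral_indicator sets_nstep[OF kernel]) simp
      then show ?thesis using power_r[of m] by linarith
    qed
  qed
  then obtain \<pi> where \<pi>: "prob_space \<pi>" "sets \<pi> = sets borel"
      "\<And>g. g \<in> borel_measurable borel \<Longrightarrow> range g \<subseteq> {0..1::real} \<Longrightarrow> mono g \<Longrightarrow>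
        (\<lambda>n. \<integral>x. g x \<partial>\<mu> n) \<longlonglongrightarrow> (\<integral>x. g x \<partial>\<pi>)" by blast
  have rate: "\<bar>measure (nstep P n x) I - measure \<pi> I\<bar> \<le> (1 - \<epsilon>) ^ (n div N)"
    if I: "I \<in> increasing_sets" for I n x
  proof -
    have "(\<lambda>k. measure (\<mu> k) I) \<longlonglongrightarrow> measure \<pi> I"
      using \<pi>(3)[OF indicator[OF I]] by (simp only: integral_indicator \<pi>(2) \<mu>_def sets_nstep[OF kernel])
    then have "(\<lambda>k. \<bar>measure (nstep P n x) I - measure (\<mu> (k + n)) I\<bar>) \<longlonglongrightarrow>
        \<bar>measure (nstep P n x) I - measure \<pi> I\<bar>"
      by (intro tendsto_intros LIMSEQ_ignore_initial_segment)
    moreover have "\<bar>measure (nstep P n x) I - measure (\<mu> (k + n)) I\<bar> \<le> (1 - \<epsilon>) ^ (n div N)" for k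
    proof -
      have "n \<le> (k + n) * N" using N by (metis mult.right_neutral mult_le_mono le_add2)
      then have "(k + n) * N = ((k + n) * N - n) + n" by simp
      then show ?thesis
        using merge[OF indicator[OF I], of "(k + n) * N - n" n c x] unfolding \<mu>_def
        by (simp only: integral_indicator sets_nstep[OF kernel] abs_minus_commute)
    qed
    ultimately show ?thesis by (intro LIMSEQ_le_const2) auto
  qed
  have vanish: "(\<lambda>k. (1 - \<epsilon>) ^ k) \<longlonglongrightarrow> 0"
    using eps eps1 by (intro LIMSEQ_power_zero) simp
  interpret \<pi>: prob_space \<pi> by (rule \<pi>(1))
  have P_\<pi>: "P \<in> \<pi> \<rightarrow>\<^sub>M subprob_algebra borel"
    using P_subprob_kernel[OF kernel] by (simp add: measurable_cong_sets[OF \<pi>(2) refl])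
  have prob_bind: "prob_space (\<pi> \<bind> P)"
    using P_\<pi> kernel by (intro \<pi>.prob_space_bind[where S = borel]) (auto simp: markov_kernel_iff)
  have sets_bind: "sets (\<pi> \<bind> P) = sets borel"
    using P_\<pi> sets_eq_imp_space_eq[OF \<pi>(2)] by (intro sets_bind) (auto simp: subprob_measurableD(2))
  have "\<pi> \<bind> P = \<pi>"
  proof (rule increasing_sets_determine_measure[OF closed_order prob_bind \<pi>(1) sets_bind \<pi>(2)])
    fix I :: "'a set" assume I: "I \<in> increasing_sets"
    define h where "h x = measure (P x) I" for x
    have h_alt: "h = (\<lambda>x. \<integral>u. indicat_real I u \<partial>nstep P 1 x)"
      unfolding h_def nstep_1[OF kernel]
      using kernel by (intro ext integral_indicator[symmetric]) (simp add: markov_kernel_iff)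
    have "(\<lambda>k. \<integral>x. h x \<partial>\<mu> k) \<longlonglongrightarrow> (\<integral>x. h x \<partial>\<pi>)"
      unfolding h_alt
      by (intro \<pi>(3) integral_nstep_measurable[OF kernel] range_integral_nstep[OF kernel monotone]
          mono_integral_nstep[OF kernel monotone] indicator[OF I])
    moreover have "(\<lambda>k. \<integral>x. h x \<partial>\<mu> k) \<longlonglongrightarrow> measure \<pi> I"
    proof (rule LIM_zero_cancel, rule Lim_null_comparison[OF _ vanish])
      have "(\<integral>x. h x \<partial>\<mu> k) = measure (nstep P (k * N + 1) c) I" for k
        unfolding h_alt \<mu>_def
        using integral_nstep_add[OF kernel indicator(1)[OF I], of 1 "k * N" 1 c]
        by (simp only: integral_indicator sets_nstep[OF kernel]) (simp add: indicator_def)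
      moreover have "(1 - \<epsilon>) ^ ((k * N + 1) div N) \<le> (1 - \<epsilon>) ^ k" for k
        using N eps eps1 by (intro power_decreasing) (simp_all add: less_eq_div_iff_mult_less_eq)
      ultimately show "\<forall>\<^sub>F k in sequentially. norm ((\<integral>x. h x \<partial>\<mu> k) - measure \<pi> I) \<le> (1 - \<epsilon>) ^ k"
        using rate[OF I] by (intro always_eventually allI) (metis order_trans real_norm_def)
    qed
    ultimately have "(\<integral>x. h x \<partial>\<pi>) = measure \<pi> I" by (rule LIMSEQ_unique)
    then show "measure (\<pi> \<bind> P) I = measure \<pi> I"
      using \<pi>.measure_bind[OF P_\<pi> increasing_sets_borel[OF I]] by (simp add: h_def)
  qed
  then have stationary: "stationary_distribution P \<pi>"
    using \<pi>(1,2) by (simp add: stationary_distribution_def)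
  have unique: "\<pi>' = \<pi>" if st: "stationary_distribution P \<pi>'" for \<pi>'
  proof -
    have \<pi>': "prob_space \<pi>'" "sets \<pi>' = sets borel" using st by (auto simp: stationary_distribution_def)
    interpret \<pi>': prob_space \<pi>' by (rule \<pi>'(1))
    show ?thesis
    proof (rule increasing_sets_determine_measure[OF closed_order \<pi>'(1) \<pi>(1) \<pi>'(2) \<pi>(2)])
      fix I :: "'a set" assume I: "I \<in> increasing_sets"
      have "\<bar>measure \<pi>' I - measure \<pi> I\<bar> \<le> (1 - \<epsilon>) ^ k" for k
      proof -
        have K: "nstep P (k * N) \<in> \<pi>' \<rightarrow>\<^sub>M subprob_algebra borel"
          using nstep_subprob_kernel[OF kernel] by (simp add: measurable_cong_sets[OF \<pi>'(2) refl])
        have eq: "measure \<pi>' I = (\<integral>x. measure (nstep P (k * N) x) I \<partial>\<pi>')"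
          using \<pi>'.measure_bind[OF K increasing_sets_borel[OF I]] stationary_nstep[OF kernel st] by simp
        have int: "integrable \<pi>' (\<lambda>x. measure (nstep P (k * N) x) I)"
          using prob_space.prob_le_1[OF prob_space_nstep[OF kernel]] increasing_sets_borel[OF I]
          by (intro \<pi>'.integrable_const_bound[of _ 1] measurable_compose[OF K]) auto
        have "measure \<pi> I - (1 - \<epsilon>) ^ k \<le> measure (nstep P (k * N) x) I"
            "measure (nstep P (k * N) x) I \<le> measure \<pi> I + (1 - \<epsilon>) ^ k" for x
          using rate[OF I, of "k * N" x] N by (simp_all add: abs_le_iff)
        then have "measure \<pi> I - (1 - \<epsilon>) ^ k \<le> measure \<pi>' I" "measure \<pi>' I \<le> measure \<pi> I + (1 - \<epsilon>) ^ k"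
          unfolding eq by (auto intro: \<pi>'.integral_ge_const[OF int] \<pi>'.integral_le_const[OF int])
        then show ?thesis by linarith
      qed
      then have "\<bar>measure \<pi>' I - measure \<pi> I\<bar> \<le> 0"
        by (intro LIMSEQ_le_const[OF vanish]) auto
      then show "measure \<pi>' I = measure \<pi> I" by simp
    qed
  qed
  have sup: "(SUP I\<in>increasing_sets. \<bar>measure (nstep P n x) I - measure \<pi> I\<bar>) \<le> (1 - \<epsilon>) ^ (n div N)"
    for n x
    using rate by (intro cSUP_least) (auto intro: UNIV_increasing)
  have sup_chain: "(SUP I\<in>increasing_sets. \<bar>\<P>(\<omega> in M. X n \<omega> \<in> I) - measure \<pi> I\<bar>) \<le> (1 - \<epsilon>) ^ (n div N)"
    if chain: "markov_chain P x M X" for x and M :: "'w measure" and X n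
  proof -
    have X: "X n \<in> borel_measurable M" using chain by (simp add: markov_chain_def)
    have "\<P>(\<omega> in M. X n \<omega> \<in> I) = measure (nstep P n x) I" if "I \<in> increasing_sets" for I
      using X increasing_sets_borel[OF that] unfolding markov_chain_law[OF kernel chain, symmetric]
      by (subst measure_distr) (auto intro!: arg_cong[of _ _ "measure M"])
    then show ?thesis using rate by (intro cSUP_least) (auto intro: UNIV_increasing)
  qed
  have geometric: "\<exists>C \<rho>. 0 \<le> \<rho> \<and> \<rho> < 1 \<and>
      (\<forall>x. \<forall>n\<ge>1. (SUP I\<in>increasing_sets. \<bar>measure (nstep P n x) I - measure \<pi> I\<bar>) \<le> C * \<rho> ^ n)"
  proof (intro exI conjI allI impI)
    show "0 \<le> root N r" "root N r < 1" using r N by simp_all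
    show "(SUP I\<in>increasing_sets. \<bar>measure (nstep P n x) I - measure \<pi> I\<bar>) \<le> (1 / r) * root N r ^ n" for n x
      using sup[of n x] power_r[of "n div N"] floor_power_le_geometric[OF r(1,2) N, of n] by linarith
  qed
  show ?thesis
    by (intro exI[of _ \<pi>] conjI allI impI geometric; (rule stationary unique sup sup_chain; assumption)?)
qed

end
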